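(* Let $T$ be an $n$-string link with a fixed abstract closure $\sigma$ to an oriented circle and a fixed point $\infty\in\partial T$, and let $m$ be the meridian of a positive quadruple crossing in $M_T^{reg}$. For each grading $A\subset\partial T$ put $$R^{(1)}_{reg}(A)(m)=\sum_{p}\mathrm{sign}(p)\,\sigma_2\sigma_1(p)+\sum_{p}\mathrm{sign}(p)\,z\,W_A(p)\,(\sigma_2(p)-\sigma_1(p))\in S(\partial T),$$ where the first sum is over all triple crossings $p$ in $m$ of global type $l_c$ or $r_a$ such that $\partial(hm)=A$, and the second sum is over all triple crossings $p$ in $m$ whose distinguished crossing $d$ is of type $0$ (global types $r_a,r_b,l_b$). Then $R^{(1)}_{reg}(A)(m)=0$ for each grading $A$.
   Context: Setting. An $n$-string link $T$ consists of $n$ ordered, oriented, properly and smoothly embedded arcs in the cube $I^3=I^2\times I$, considered via the orthogonal projection $pr:I^3\to I^2$. Abstract arcs $\sigma$ are added (not embedded) so that $T\cup\sigma$ is one oriented circle; $\infty$ is a point of $\partial T$ on this circle. $M_T^{reg}$ is the space of string links regularly isotopic to $T$ (all projections are immersions; boundary fixed). $S(\partial T)$ is the HOMFLYPT skein module over $\mathbb{Z}[v^{\pm1},z^{\pm1}]$ of oriented tangle diagrams up to regular isotopy with oriented boundary $\partial T$: (positive crossing) $-$ (negative crossing) $= z\cdot$(oriented smoothing), a positive (negative) kink contributes $v$ ($v^{-1}$), and a trivial component contributes $\delta=(v-v^{-1})/z$. Crossings. Starting at $\infty$ and following the oriented circle, a crossing $q$ is of type $1$ if its under-cross is met before its over-cross,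 and of type $0$ otherwise. For $q$ of type $1$, $D_q^+$ is the arc of the circle from the over-cross to the under-cross of $q$ (it contains $\infty$), and the grading of $q$ is $\partial q=D_q^+\cap\partial T$; gradings $A$ are cyclically ordered subsets of $\partial T$ with alternating signs containing $\infty$. $w(q)=\pm1$ is the writhe of $q$. Triple crossings. At a triple crossing $p$ the three branches are called low, mid, high according to height. The distinguished crossing $d$ is between low and high, $hm$ is between high and mid, $ml$ is between mid and low. The global type of $p$ is determined by the order in which the branches are met from $\infty$: $r_a$: mid, high, low; $r_b$: high, low, mid; $l_b$: high, mid, low; $l_c$: mid, low, high. So $d$ is of type $0$ exactly for $r_a,r_b,l_b$. When $d$ is of type $0$, an f-crossing of $p$ is a crossing $q\neq d$ of type $1$ whose under-cross lies on the oriented arc from $\infty$ to the over-cross of $d$; $W_A(p)=\sum w(q)$ over all f-crossings $q$ with $\partial q=A$ (crossings of the triangle such as $hm$ are included if they satisfy the definition). Positive triple crossings and smoothings. Braid words are read in the direction of the orientation, and positions are numbered so that in the positive crossing $\sigma_i$ the strand going from position $i$ to $i+1$ is the under strand. A triple crossing is positive if its three crossings are positive; then its perturbations are $\sigma_1\sigma_2\sigma_1$ and $\sigma_2\sigma_1\sigma_2$, and the Reidemeister move $\sigma_1\sigma_2\sigma_1\to\sigma_2\sigma_1\sigma_2$ has sign $+1$, its inverse sign $-1$. For a 3-braid $\beta$, $\beta(p)\in S(\partial T)$ is the element obtained by replacing the triple crossing by $\beta$. Quadruple crossings. A positive quadruple crossing is a point where four branches $1,2,3,4$ (from lowest to highest)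 meet in one point of the projection, pairwise transversally, forming a braid with all six crossings positive after perturbation. Its meridian $m$ is the loop in $M_T^{reg}$ which is constant outside the quadruple crossing and which inside passes (up to far commutation) through the eight positive Reidemeister III moves given, with their signs, by $P_3:[121\to212]321\,(+)$, $P_4:21[232\to323]1\,(+)$, $\bar P_1:23[121\to212]3\,(+)$, $\bar P_2:[232\to323]123\,(+)$, $\bar P_3:321[323\to232]\,(-)$, $\bar P_4:3[212\to121]32\,(-)$, $P_1:1[323\to232]12\,(-)$, $P_2:123[212\to121]\,(-)$, where $i$ stands for $\sigma_i$. No assumption is made on the order in which the circle passes the four branches or on the position of $\infty$. *)

theory Defs
  imports Complex_Main "HOL-Library.Poly_Mapping" "HOL-Library.Product_Plus"
begin

section \<open>Oriented tangle diagrams\<close>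

text \<open>
  An oriented tangle diagram in the square is cut by horizontal lines into elementary slices, which
  are read from top to bottom. All end points lie on the top or the bottom edge of the square; every
  pattern of end points on the boundary of a disc is of this form up to a planar homeomorphism.
  Strands on a horizontal line are numbered from left to right, starting with 0.

  \<^item> \<open>Cross k h\<close> crosses the strands \<open>k\<close> and \<open>k + 1\<close>; \<open>h\<close> says that the strand running
    from upper left to lower right is the under strand.
  \<^item> \<open>Birth k o\<close> is a local maximum, whose two legs become the strands \<open>k\<close> (with orientation \<open>o\<close>)
    and \<open>k + 1\<close> below it.
  \<^item> \<open>Death k\<close> is a local minimum, joining the strands \<open>k\<close> and \<open>k + 1\<close>.
\<close>

datatype orient = Down | Up

fun flip :: "orient \<Rightarrow> orient" where
  "flip Down = Up"
| "flip Up = Down"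

datatype slice = Cross nat bool | Birth nat orient | Death nat

datatype diagram = Diagram (top_word: "orient list") (slices: "slice list")

fun fits :: "slice \<Rightarrow> orient list \<Rightarrow> bool" where
  "fits (Cross k h) u \<longleftrightarrow> k + 1 < length u"
| "fits (Birth k o') u \<longleftrightarrow> k \<le> length u"
| "fits (Death k) u \<longleftrightarrow> k + 1 < length u \<and> u ! k \<noteq> u ! (k + 1)"

fun act :: "slice \<Rightarrow> orient list \<Rightarrow> orient list" where
  "act (Cross k h) u = u[k := u ! (k + 1), k + 1 := u ! k]"
| "act (Birth k o') u = take k u @ [o', flip o'] @ drop k u"
| "act (Death k) u = take k u @ drop (k + 2) u"

definition level :: "diagram \<Rightarrow> nat \<Rightarrow> orient list" where
  "level D i = fold act (take i (slices D)) (top_word D)"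

definition bottom_word :: "diagram \<Rightarrow> orient list" where
  "bottom_word D = level D (length (slices D))"

definition wf_diagram :: "diagram \<Rightarrow> bool" where
  "wf_diagram D \<longleftrightarrow> (\<forall>i < length (slices D). fits (slices D ! i) (level D i))"

text \<open>The oriented boundary is recorded by the words on the top and on the bottom edge.\<close>

type_synonym boundary_type = "orient list \<times> orient list"

definition boundary_type :: "diagram \<Rightarrow> boundary_type" where
  "boundary_type D = (top_word D, bottom_word D)"

definition tangles :: "boundary_type \<Rightarrow> diagram set" where
  "tangles b = {D. wf_diagram D \<and> boundary_type D = b}"

definition crossings :: "diagram \<Rightarrow> nat set" where
  "crossings D = {i. i < length (slices D) \<and> (\<exists>k h. slices D ! i = Cross k h)}"

text \<open>
  If both strands of \<open>Cross k h\<close> point down (or both up), the crossing is positive iff \<open>h\<close>;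
  reversing one strand changes the sign.
\<close>

fun slice_sign :: "orient list \<Rightarrow> slice \<Rightarrow> int" where
  "slice_sign u (Cross k h) = (if h = (u ! k = u ! (k + 1)) then 1 else - 1)"
| "slice_sign u s = 0"

definition writhe :: "diagram \<Rightarrow> nat \<Rightarrow> int" where
  "writhe D i = slice_sign (level D i) (slices D ! i)"


section \<open>Regular isotopy\<close>

fun offset :: "slice \<Rightarrow> nat" where
  "offset (Cross k h) = k"
| "offset (Birth k o') = k"
| "offset (Death k) = k"

fun set_offset :: "nat \<Rightarrow> slice \<Rightarrow> slice" where
  "set_offset k (Cross k' h) = Cross k h"
| "set_offset k (Birth k' o') = Birth k o'"
| "set_offset k (Death k') = Death k"

fun inputs :: "slice \<Rightarrow> nat" where
  "inputs (Cross k h) = 2"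
| "inputs (Birth k o') = 0"
| "inputs (Death k) = 2"

fun outputs :: "slice \<Rightarrow> nat" where
  "outputs (Cross k h) = 2"
| "outputs (Birth k o') = 2"
| "outputs (Death k) = 0"

text \<open>
  \<open>far\<close>, \<open>zigzag\<close> and \<open>slide\<close> are the moves of planar isotopy with respect to the height function:
  exchanging the heights of two remote slices, cancelling a maximum against a minimum, and moving a
  crossing past a maximum or a minimum. The other ones are the Reidemeister moves II and III. Moves
  for the remaining orientations and directions of the strands follow from these. In \<open>R3\<close> the three
  strands are \<open>X, Y, Z\<close> from left to right at the top; \<open>h1, h2, h3\<close> say that \<open>X\<close> is under \<open>Y\<close>,
  \<open>X\<close> is under \<open>Z\<close>, \<open>Y\<close> is under \<open>Z\<close>, and the premise excludes the two cyclic choices.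
\<close>

inductive local_move :: "slice list \<Rightarrow> slice list \<Rightarrow> bool" where
  far: "offset s \<ge> offset r + outputs r \<Longrightarrow>
    local_move [r, s] [set_offset (offset s - outputs r + inputs r) s, r]"
| zigzag1: "local_move [Birth (k + 1) o', Death k] []"
| zigzag2: "local_move [Birth k o', Death (k + 1)] []"
| slide_max: "local_move [Birth k o', Cross (k + 1) h] [Birth (k + 1) o', Cross k (\<not> h)]"
| slide_min: "local_move [Cross k h, Death (k + 1)] [Cross (k + 1) (\<not> h), Death k]"
| R2: "local_move [Cross k h, Cross k (\<not> h)] []"
| R3: "\<not> (h1 = h3 \<and> h2 \<noteq> h1) \<Longrightarrow>
    local_move [Cross k h1, Cross (k + 1) h2, Cross k h3]
               [Cross (k + 1) h3, Cross k h2, Cross (k + 1) h1]"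

inductive isotopy_step :: "diagram \<Rightarrow> diagram \<Rightarrow> bool" where
  "local_move ss ss' \<Longrightarrow>
   wf_diagram (Diagram u (xs @ ss @ ys)) \<Longrightarrow> wf_diagram (Diagram u (xs @ ss' @ ys)) \<Longrightarrow>
   isotopy_step (Diagram u (xs @ ss @ ys)) (Diagram u (xs @ ss' @ ys))"

definition regularly_isotopic :: "diagram \<Rightarrow> diagram \<Rightarrow> bool" where
  "regularly_isotopic = equivclp isotopy_step"


section \<open>The HOMFLYPT skein module\<close>

text \<open>
  \<open>laurent\<close> is the group ring over the integers of the free abelian group on \<open>v\<close> and \<open>z\<close>,
  that is, the ring of Laurent polynomials; \<open>Poly_Mapping.single (a, b) c\<close> is \<open>c v^a z^b\<close>.
\<close>

type_synonym laurent = "(int \<times> int) \<Rightarrow>\<^sub>0 int"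

definition laurent_v :: laurent where "laurent_v = Poly_Mapping.single (1, 0) 1"
definition laurent_v_inv :: laurent where "laurent_v_inv = Poly_Mapping.single (- 1, 0) 1"
definition laurent_z :: laurent where "laurent_z = Poly_Mapping.single (0, 1) 1"
definition laurent_z_inv :: laurent where "laurent_z_inv = Poly_Mapping.single (0, - 1) 1"

definition delta :: laurent where
  "delta = (laurent_v - laurent_v_inv) * laurent_z_inv"

type_synonym skein_element = "diagram \<Rightarrow>\<^sub>0 laurent"

definition gen :: "diagram \<Rightarrow> skein_element" where
  "gen D = Poly_Mapping.single D 1"

definition smul :: "laurent \<Rightarrow> skein_element \<Rightarrow> skein_element" where
  "smul c x = Poly_Mapping.map ((*) c) x"

lemma lookup_smul [simp]: "Poly_Mapping.lookup (smul c x) D = c * Poly_Mapping.lookup x D"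
  by (simp add: smul_def Poly_Mapping.map.rep_eq when_def)

interpretation skein: module smul
  by unfold_locales (auto intro!: poly_mapping_eqI simp: lookup_add algebra_simps)

text \<open>The oriented smoothing of \<open>Cross k h\<close> below a line with orientations \<open>u\<close>.\<close>

definition smoothing :: "orient list \<Rightarrow> nat \<Rightarrow> slice list" where
  "smoothing u k = (if u ! k = u ! (k + 1) then [] else [Death k, Birth k (u ! (k + 1))])"

text \<open>
  In both kinks (curl on the right or on the left of the strand) well-formedness forces the two
  crossing strands to be parallel, so that the sign of the kink is given by \<open>h\<close>.
\<close>

inductive_set skein_relations :: "boundary_type \<Rightarrow> skein_element set" for b where
  isotopy: "D \<in> tangles b \<Longrightarrow> regularly_isotopic D D' \<Longrightarrow> gen D - gen D' \<in> skein_relations b"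
| crossing: "Diagram u (xs @ Cross k h # ys) \<in> tangles b \<Longrightarrow>
    slice_sign (fold act xs u) (Cross k h) = 1 \<Longrightarrow>
    gen (Diagram u (xs @ Cross k h # ys)) - gen (Diagram u (xs @ Cross k (\<not> h) # ys))
      - smul laurent_z (gen (Diagram u (xs @ smoothing (fold act xs u) k @ ys)))
      \<in> skein_relations b"
| kink_right: "Diagram u (xs @ [Birth (k + 1) o', Cross k h, Death (k + 1)] @ ys) \<in> tangles b \<Longrightarrow>
    gen (Diagram u (xs @ [Birth (k + 1) o', Cross k h, Death (k + 1)] @ ys))
      - smul (if h then laurent_v else laurent_v_inv) (gen (Diagram u (xs @ ys)))
      \<in> skein_relations b"
| kink_left: "Diagram u (xs @ [Birth k o', Cross (k + 1) h, Death k] @ ys) \<in> tangles b \<Longrightarrow>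
    gen (Diagram u (xs @ [Birth k o', Cross (k + 1) h, Death k] @ ys))
      - smul (if h then laurent_v else laurent_v_inv) (gen (Diagram u (xs @ ys)))
      \<in> skein_relations b"
| circle: "Diagram u (xs @ [Birth k o', Death k] @ ys) \<in> tangles b \<Longrightarrow>
    gen (Diagram u (xs @ [Birth k o', Death k] @ ys)) - smul delta (gen (Diagram u (xs @ ys)))
      \<in> skein_relations b"

text \<open>
  The skein module of the boundary \<open>b\<close> is the free module on \<open>tangles b\<close> modulo the submodule
  spanned by \<open>skein_relations b\<close>; \<open>skein_eq b\<close> is equality in this quotient.
\<close>

definition skein_eq :: "boundary_type \<Rightarrow> skein_element \<Rightarrow> skein_element \<Rightarrow> bool" where
  "skein_eq b x y \<longleftrightarrow> x - y \<in> skein.span (skein_relations b)"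


section \<open>String links and their abstract closures\<close>

text \<open>A point \<open>(i, j)\<close> of a diagram is the point of strand \<open>j\<close> on the line above slice \<open>i\<close>.\<close>

type_synonym point = "nat \<times> nat"

definition points :: "diagram \<Rightarrow> point set" where
  "points D = {(i, j). i \<le> length (slices D) \<and> j < length (level D i)}"

text \<open>
  End points on the top and on the bottom edge. As points of the diagram they are distinct as soon as
  there is a slice; below, there are always at least the six crossings of a quadruple crossing.
\<close>

datatype bpoint = Top nat | Bottom nat

fun bpoint_point :: "diagram \<Rightarrow> bpoint \<Rightarrow> point" where
  "bpoint_point D (Top j) = (0, j)"
| "bpoint_point D (Bottom j) = (length (slices D), j)"

definition starts :: "diagram \<Rightarrow> bpoint set" where
  "starts D = {Top j |j. j < length (top_word D) \<and> top_word D ! j = Down} \<union>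
              {Bottom j |j. j < length (bottom_word D) \<and> bottom_word D ! j = Up}"

definition ends :: "diagram \<Rightarrow> bpoint set" where
  "ends D = {Top j |j. j < length (top_word D) \<and> top_word D ! j = Up} \<union>
            {Bottom j |j. j < length (bottom_word D) \<and> bottom_word D ! j = Down}"

definition bpoints :: "diagram \<Rightarrow> bpoint set" where
  "bpoints D = starts D \<union> ends D"

text \<open>
  One step along the oriented tangle: the result is \<open>Inl\<close> of the next point, or \<open>Inr\<close> of the
  boundary point at which the arc leaves the square.
\<close>

fun through_down :: "slice \<Rightarrow> point \<Rightarrow> point" where
  "through_down (Cross k h) (i, j) =
     (i + 1, if j = k then k + 1 else if j = k + 1 then k else j)"
| "through_down (Birth k o') (i, j) = (i + 1, if j < k then j else j + 2)"
| "through_down (Death k) (i, j) =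
     (if j < k then (i + 1, j) else if j = k then (i, k + 1) else if j = k + 1 then (i, k)
      else (i + 1, j - 2))"

fun through_up :: "slice \<Rightarrow> point \<Rightarrow> point" where
  "through_up (Cross k h) (i, j) =
     (i - 1, if j = k then k + 1 else if j = k + 1 then k else j)"
| "through_up (Birth k o') (i, j) =
     (if j < k then (i - 1, j) else if j = k then (i, k + 1) else if j = k + 1 then (i, k)
      else (i - 1, j - 2))"
| "through_up (Death k) (i, j) = (i - 1, if j < k then j else j + 2)"

fun tangle_step :: "diagram \<Rightarrow> point \<Rightarrow> point + bpoint" where
  "tangle_step D (i, j) =
     (case level D i ! j of
        Down \<Rightarrow> if i = length (slices D) then Inr (Bottom j)
                else Inl (through_down (slices D ! i) (i, j))
      | Up \<Rightarrow> if i = 0 then Inr (Top j)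
              else Inl (through_up (slices D ! (i - 1)) (i, j)))"

text \<open>A string link diagram consists of \<open>n\<close> arcs: every point lies on an arc from the boundary.\<close>

definition string_link :: "nat \<Rightarrow> diagram \<Rightarrow> bool" where
  "string_link n D \<longleftrightarrow> wf_diagram D \<and> card (starts D) = n \<and>
     (\<forall>x \<in> points D. \<exists>s \<in> starts D.
        (bpoint_point D s, x) \<in> {(y, y'). tangle_step D y = Inl y'}\<^sup>*)"

text \<open>The abstract closing arcs are given by the map \<open>\<sigma>\<close> from their first to their last points.\<close>

definition circle_step :: "diagram \<Rightarrow> (bpoint \<Rightarrow> bpoint) \<Rightarrow> point \<Rightarrow> point" where
  "circle_step D \<sigma> x =
     (case tangle_step D x of Inl y \<Rightarrow> y | Inr e \<Rightarrow> bpoint_point D (\<sigma> e))"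

definition abstract_closure :: "diagram \<Rightarrow> (bpoint \<Rightarrow> bpoint) \<Rightarrow> bool" where
  "abstract_closure D \<sigma> \<longleftrightarrow> bij_betw \<sigma> (ends D) (starts D) \<and>
     (\<forall>x \<in> points D. \<forall>y \<in> points D. \<exists>m. (circle_step D \<sigma> ^^ m) x = y)"


section \<open>Crossings of a closed string link diagram with base point\<close>

text \<open>The number of steps after which a point is met on the circle, starting at the base
  point \<open>base\<close>, which plays the role of infinity.\<close>

definition time :: "diagram \<Rightarrow> (bpoint \<Rightarrow> bpoint) \<Rightarrow> bpoint \<Rightarrow> point \<Rightarrow> nat" where
  "time D \<sigma> base x = (LEAST m. (circle_step D \<sigma> ^^ m) (bpoint_point D base) = x)"

text \<open>
  Each of the two passages through a crossing takes place directly after the point at which the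
  oriented strand enters the slice.
\<close>

definition falling_entry :: "diagram \<Rightarrow> nat \<Rightarrow> point" where
  "falling_entry D q = (let k = offset (slices D ! q) in
     if level D q ! k = Down then (q, k) else (q + 1, k + 1))"

definition rising_entry :: "diagram \<Rightarrow> nat \<Rightarrow> point" where
  "rising_entry D q = (let k = offset (slices D ! q) in
     if level D q ! (k + 1) = Down then (q, k + 1) else (q + 1, k))"

definition under_entry :: "diagram \<Rightarrow> nat \<Rightarrow> point" where
  "under_entry D q =
     (case slices D ! q of Cross k h \<Rightarrow> if h then falling_entry D q else rising_entry D q)"

definition over_entry :: "diagram \<Rightarrow> nat \<Rightarrow> point" where
  "over_entry D q =
     (case slices D ! q of Cross k h \<Rightarrow> if h then rising_entry D q else falling_entry D q)"

definition type1 :: "diagram \<Rightarrow> (bpoint \<Rightarrow> bpoint) \<Rightarrow> bpoint \<Rightarrow> nat \<Rightarrow> bool" where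
  "type1 D \<sigma> base q \<longleftrightarrow> time D \<sigma> base (under_entry D q) < time D \<sigma> base (over_entry D q)"

definition type0 :: "diagram \<Rightarrow> (bpoint \<Rightarrow> bpoint) \<Rightarrow> bpoint \<Rightarrow> nat \<Rightarrow> bool" where
  "type0 D \<sigma> base q \<longleftrightarrow> \<not> type1 D \<sigma> base q"

text \<open>
  For a crossing of type 1, the boundary points on the arc from the over-cross through infinity to
  the under-cross. A boundary point can be the entry point of a passage; it then precedes the
  passage, whence the asymmetry of the inequalities.
\<close>

definition crossing_grading ::
  "diagram \<Rightarrow> (bpoint \<Rightarrow> bpoint) \<Rightarrow> bpoint \<Rightarrow> nat \<Rightarrow> bpoint set" where
  "crossing_grading D \<sigma> base q = {e \<in> bpoints D.
     time D \<sigma> base (over_entry D q) < time D \<sigma> base (bpoint_point D e) \<or>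
     time D \<sigma> base (bpoint_point D e) \<le> time D \<sigma> base (under_entry D q)}"

text \<open>
  Sets of boundary points containing infinity, such that from each of its points the next point of
  the set on the oriented circle has the other sign.
\<close>

definition grading ::
  "diagram \<Rightarrow> (bpoint \<Rightarrow> bpoint) \<Rightarrow> bpoint \<Rightarrow> bpoint set \<Rightarrow> bool" where
  "grading D \<sigma> base A \<longleftrightarrow> A \<subseteq> bpoints D \<and> base \<in> A \<and>
     (\<forall>a \<in> A. \<exists>b \<in> A. (a \<in> starts D \<longleftrightarrow> b \<notin> starts D) \<and>
        (\<exists>m > 0. (circle_step D \<sigma> ^^ m) (bpoint_point D a) = bpoint_point D b \<and>
           (\<forall>l. 0 < l \<and> l < m \<longrightarrow>
              (circle_step D \<sigma> ^^ l) (bpoint_point D a) \<notin> bpoint_point D ` A)))"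

definition f_crossings ::
  "diagram \<Rightarrow> (bpoint \<Rightarrow> bpoint) \<Rightarrow> bpoint \<Rightarrow> nat \<Rightarrow> nat set" where
  "f_crossings D \<sigma> base d = {q \<in> crossings D. q \<noteq> d \<and> type1 D \<sigma> base q \<and>
     time D \<sigma> base (under_entry D q) < time D \<sigma> base (over_entry D d)}"


section \<open>The meridian of a positive quadruple crossing\<close>

text \<open>
  A diagram with a positive quadruple crossing: below the slices \<open>above\<close>, the strands \<open>shift\<close>
  to \<open>shift + 3\<close> all point down and meet in one point; \<open>below\<close> are the remaining slices.
  (Pairwise positivity forces the four directions into an open half plane, so that the crossing can
  be rotated to this position.) The branches are, from left to right above the quadruple crossing,
  ordered from the lowest to the highest.
\<close>

record quadruple =
  q_top :: "orient list"
  above :: "slice list"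
  shift :: nat
  below :: "slice list"

definition positive_quadruple :: "quadruple \<Rightarrow> bool" where
  "positive_quadruple Q \<longleftrightarrow>
     (\<forall>i < 4. shift Q + i < length (fold act (above Q) (q_top Q)) \<and>
              fold act (above Q) (q_top Q) ! (shift Q + i) = Down)"

text \<open>
  Braid words are lists of indices in \<open>{1, 2, 3}\<close>. Going down, the under strand of the positive
  crossing \<open>Cross k True\<close> moves one position to the right, as required for the generators.
\<close>

definition insert_braid :: "quadruple \<Rightarrow> nat list \<Rightarrow> diagram" where
  "insert_braid Q w =
     Diagram (q_top Q) (above Q @ map (\<lambda>i. Cross (shift Q + (i - 1)) True) w @ below Q)"

text \<open>
  A triple crossing \<open>p\<close> in the meridian: the braid is \<open>pre p\<close>, then a positive triple crossing of
  the strands at the positions \<open>pos p\<close>, \<open>pos p + 1\<close>, \<open>pos p + 2\<close>, then \<open>post p\<close>.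
\<close>

record triple =
  pre :: "nat list"
  pos :: nat
  post :: "nat list"
  sign :: int

definition meridian :: "triple set" where
  "meridian = {
     \<lparr>pre = [],        pos = 1, post = [3, 2, 1], sign = 1\<rparr>,
     \<lparr>pre = [2, 1],    pos = 2, post = [1],       sign = 1\<rparr>,
     \<lparr>pre = [2, 3],    pos = 1, post = [3],       sign = 1\<rparr>,
     \<lparr>pre = [],        pos = 2, post = [1, 2, 3], sign = 1\<rparr>,
     \<lparr>pre = [3, 2, 1], pos = 2, post = [],        sign = - 1\<rparr>,
     \<lparr>pre = [3],       pos = 1, post = [3, 2],    sign = - 1\<rparr>,
     \<lparr>pre = [1],       pos = 2, post = [1, 2],    sign = - 1\<rparr>,
     \<lparr>pre = [1, 2, 3], pos = 1, post = [],        sign = - 1\<rparr>}"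

definition replace_triple :: "quadruple \<Rightarrow> triple \<Rightarrow> nat list \<Rightarrow> diagram" where
  "replace_triple Q p w = insert_braid Q (pre p @ map (\<lambda>i. i + (pos p - 1)) w @ post p)"

text \<open>
  Crossings, types and gradings at the triple crossing \<open>p\<close> are read off from its perturbation
  121. There, the branches from left to right above the triple crossing are low, mid and high, and
  the three crossings are, from top to bottom, \<open>ml\<close>, \<open>d\<close> and \<open>hm\<close>. (In the perturbation 212 the
  order of the three crossings is reversed. This exchanges only the consecutive passages of one and
  the same branch through two crossings of the triangle, and changes none of the notions below.)
\<close>

definition perturbation :: "quadruple \<Rightarrow> triple \<Rightarrow> diagram" where
  "perturbation Q p = replace_triple Q p [1, 2, 1]"

definition triple_level :: "quadruple \<Rightarrow> triple \<Rightarrow> nat" where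
  "triple_level Q p = length (above Q) + length (pre p)"

definition d_crossing :: "quadruple \<Rightarrow> triple \<Rightarrow> nat" where
  "d_crossing Q p = triple_level Q p + 1"

definition hm_crossing :: "quadruple \<Rightarrow> triple \<Rightarrow> nat" where
  "hm_crossing Q p = triple_level Q p + 2"

definition low :: "quadruple \<Rightarrow> triple \<Rightarrow> point" where
  "low Q p = (triple_level Q p, shift Q + (pos p - 1))"

definition mid :: "quadruple \<Rightarrow> triple \<Rightarrow> point" where
  "mid Q p = (triple_level Q p, shift Q + (pos p - 1) + 1)"

definition high :: "quadruple \<Rightarrow> triple \<Rightarrow> point" where
  "high Q p = (triple_level Q p, shift Q + (pos p - 1) + 2)"

definition met_in_order ::
  "quadruple \<Rightarrow> (bpoint \<Rightarrow> bpoint) \<Rightarrow> bpoint \<Rightarrow> triple \<Rightarrow> point list \<Rightarrow> bool" where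
  "met_in_order Q \<sigma> base p xs \<longleftrightarrow> sorted_wrt (<) (map (time (perturbation Q p) \<sigma> base) xs)"

definition global_type_ra where
  "global_type_ra Q \<sigma> base p \<longleftrightarrow> met_in_order Q \<sigma> base p [mid Q p, high Q p, low Q p]"

definition global_type_lc where
  "global_type_lc Q \<sigma> base p \<longleftrightarrow> met_in_order Q \<sigma> base p [mid Q p, low Q p, high Q p]"

definition d_type0 where
  "d_type0 Q \<sigma> base p \<longleftrightarrow> type0 (perturbation Q p) \<sigma> base (d_crossing Q p)"

definition hm_grading ::
  "quadruple \<Rightarrow> (bpoint \<Rightarrow> bpoint) \<Rightarrow> bpoint \<Rightarrow> triple \<Rightarrow> bpoint set" where
  "hm_grading Q \<sigma> base p = crossing_grading (perturbation Q p) \<sigma> base (hm_crossing Q p)"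

definition W_sum ::
  "quadruple \<Rightarrow> (bpoint \<Rightarrow> bpoint) \<Rightarrow> bpoint \<Rightarrow> bpoint set \<Rightarrow> triple \<Rightarrow> int" where
  "W_sum Q \<sigma> base A p = (let D = perturbation Q p in
     \<Sum>q | q \<in> f_crossings D \<sigma> base (d_crossing Q p) \<and> crossing_grading D \<sigma> base q = A. writhe D q)"

definition R1_reg ::
  "quadruple \<Rightarrow> (bpoint \<Rightarrow> bpoint) \<Rightarrow> bpoint \<Rightarrow> bpoint set \<Rightarrow> skein_element" where
  "R1_reg Q \<sigma> base A =
     (\<Sum>p | p \<in> meridian \<and> (global_type_lc Q \<sigma> base p \<or> global_type_ra Q \<sigma> base p) \<and>
            hm_grading Q \<sigma> base p = A.
        smul (of_int (sign p)) (gen (replace_triple Q p [2, 1]))) +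
     (\<Sum>p | p \<in> meridian \<and> d_type0 Q \<sigma> base p.
        smul (of_int (sign p) * laurent_z * of_int (W_sum Q \<sigma> base A p))
          (gen (replace_triple Q p [2]) - gen (replace_triple Q p [1])))"

end

theory Submission
  imports Defs
begin

text \<open>
  Write \<open>P'\<^sub>i\<close> for the partner of \<open>P\<^sub>i\<close> on the other side of the fourth branch. Up to one exception,
  all crossings contribute equally to the weights of triple crossings with the same \<open>d\<close>: if
  the crossing 34 is of type 1 with grading \<open>A\<close>, it is an f-crossing of \<open>P'\<^sub>3\<close> but not of \<open>P\<^sub>3\<close>.
  Apart from this, the second sum vanishes: for \<open>P\<^sub>2, P'\<^sub>2\<close> and for \<open>P\<^sub>3, P'\<^sub>3\<close> by the braid
  relations, and for \<open>P\<^sub>1, P'\<^sub>1, P\<^sub>4, P'\<^sub>4\<close>, which share \<open>d = 14\<close>, by these together with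
  \<open>ii = 1 + z i\<close>. In the first sum everything cancels except \<open>z (2321 - 1321)\<close>, which
  comes from \<open>P\<^sub>1, P'\<^sub>1\<close> with \<open>hm = 34\<close>. It appears precisely if branch 3 precedes the branches 1 and 4
  and the grading of 34 is \<open>A\<close>; this is also the condition for the exceptional term
  \<open>- z (2321 - 1321)\<close> of \<open>P'\<^sub>3\<close>.
\<close>

section \<open>Well-formedness and exchange of the crossings in the block\<close>

primrec wf_slices :: "orient list \<Rightarrow> slice list \<Rightarrow> bool" where
  "wf_slices u [] \<longleftrightarrow> True"
| "wf_slices u (c # cs) \<longleftrightarrow> fits c u \<and> wf_slices (act c u) cs"

text \<open>The recursive form splits over append, so the slices above, inside and below the block
  can be treated separately.\<close>

lemma wf_diagram_iff_wf_slices: "wf_diagram (Diagram u cs) \<longleftrightarrow> wf_slices u cs"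
proof (induction cs arbitrary: u)
  case (Cons c cs)
  have "wf_diagram (Diagram u (c # cs)) \<longleftrightarrow> fits c u \<and> wf_diagram (Diagram (act c u) cs)"
    by (simp add: wf_diagram_def level_def All_less_Suc2)
  then show ?case
    using Cons.IH by simp
qed (simp add: wf_diagram_def)

lemma wf_slices_append [simp]:
  "wf_slices u (xs @ ys) \<longleftrightarrow> wf_slices u xs \<and> wf_slices (fold act xs u) ys"
  by (induction xs arbitrary: u) auto

lemma act_Cross_parallel: "u ! k = u ! (k + 1) \<Longrightarrow> act (Cross k h) u = u"
  by (metis act.simps(1) list_update_id)

text \<open>More general than \<open>insert_braid\<close>: the skein relation creates negative
  crossings in the block, which positive braid words cannot express.\<close>

definition plug :: "quadruple \<Rightarrow> slice list \<Rightarrow> diagram" where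
  "plug Q cs = Diagram (q_top Q) (above Q @ cs @ below Q)"

definition local_crossings :: "quadruple \<Rightarrow> slice list \<Rightarrow> bool" where
  "local_crossings Q cs \<longleftrightarrow> (\<forall>c \<in> set cs. \<exists>i h. i < 3 \<and> c = Cross (shift Q + i) h)"

definition middle_word :: "quadruple \<Rightarrow> orient list" where
  "middle_word Q = fold act (above Q) (q_top Q)"

lemma middle_word_Down:
  "positive_quadruple Q \<Longrightarrow> i < 4 \<Longrightarrow>
    shift Q + i < length (middle_word Q) \<and> middle_word Q ! (shift Q + i) = Down"
  by (simp add: positive_quadruple_def middle_word_def)

lemma act_local_crossing:
  assumes "positive_quadruple Q" "i < 3"
  shows "act (Cross (shift Q + i) h) (middle_word Q) = middle_word Q"
    "fits (Cross (shift Q + i) h) (middle_word Q)"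
proof -
  show "act (Cross (shift Q + i) h) (middle_word Q) = middle_word Q"
    using middle_word_Down[OF assms(1), of i] middle_word_Down[OF assms(1), of "i + 1"] assms(2)
    by (intro act_Cross_parallel) (simp add: add.assoc)
  show "fits (Cross (shift Q + i) h) (middle_word Q)"
    using middle_word_Down[OF assms(1), of "i + 1"] assms(2) by (simp add: add.assoc)
qed

lemma local_crossings_middle:
  assumes "positive_quadruple Q" "local_crossings Q cs"
  shows "fold act cs (middle_word Q) = middle_word Q" "wf_slices (middle_word Q) cs"
  using assms(2)
  by (induction cs) (use act_local_crossing[OF assms(1)] in \<open>auto simp: local_crossings_def\<close>)

lemma local_crossings_take: "local_crossings Q cs \<Longrightarrow> local_crossings Q (take n cs)"
  by (auto simp: local_crossings_def dest: in_set_takeD)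

lemma local_crossings_append [simp]:
  "local_crossings Q (xs @ ys) \<longleftrightarrow> local_crossings Q xs \<and> local_crossings Q ys"
  by (auto simp: local_crossings_def)

text \<open>The four strands point down, so crossings in the block leave the orientations at
  \<open>middle_word Q\<close>. On lines inside the block the truncated subtraction is 0, which
  gives this word. Only the length of \<open>cs\<close> enters.\<close>

lemma level_plug:
  assumes "positive_quadruple Q" "local_crossings Q cs"
  shows "level (plug Q cs) i =
    (if i \<le> length (above Q) then fold act (take i (above Q)) (q_top Q)
     else fold act (take (i - (length (above Q) + length cs)) (below Q)) (middle_word Q))"
proof (cases "i \<le> length (above Q)")
  case False
  then show ?thesis
    using local_crossings_middle(1)[OF assms(1) local_crossings_take[OF assms(2)]]
    by (simp add: level_def plug_def flip: middle_word_def)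
qed (simp add: level_def plug_def)

lemma boundary_type_plug:
  assumes "positive_quadruple Q" "local_crossings Q cs" "local_crossings Q cs'"
  shows "boundary_type (plug Q cs) = boundary_type (plug Q cs')"
  using local_crossings_middle(1)[OF assms(1,2)] local_crossings_middle(1)[OF assms(1,3)]
  by (simp add: boundary_type_def bottom_word_def level_def plug_def flip: middle_word_def)

lemma wf_diagram_plug:
  assumes "positive_quadruple Q" "local_crossings Q cs" "local_crossings Q cs'"
    and "wf_diagram (plug Q cs)"
  shows "wf_diagram (plug Q cs')"
  using assms local_crossings_middle[OF assms(1,2)] local_crossings_middle[OF assms(1,3)]
  by (simp add: plug_def wf_diagram_iff_wf_slices flip: middle_word_def)

definition braid_slices :: "quadruple \<Rightarrow> nat list \<Rightarrow> slice list" where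
  "braid_slices Q w = map (\<lambda>i. Cross (shift Q + (i - 1)) True) w"

lemma insert_braid_plug: "insert_braid Q w = plug Q (braid_slices Q w)"
  by (simp add: insert_braid_def plug_def braid_slices_def)

lemma length_braid_slices [simp]: "length (braid_slices Q w) = length w"
  by (simp add: braid_slices_def)

lemma braid_slices_append [simp]: "braid_slices Q (x @ y) = braid_slices Q x @ braid_slices Q y"
  by (simp add: braid_slices_def)

lemma local_crossings_braid_slices: "set w \<subseteq> {1, 2, 3} \<Longrightarrow> local_crossings Q (braid_slices Q w)"
  by (force simp: local_crossings_def braid_slices_def)


section \<open>Braid relations in the skein module\<close>

lemma skein_eq_refl [simp]: "skein_eq b x x"
  by (simp add: skein_eq_def skein.span_zero)

lemma skein_eq_sym: "skein_eq b x y \<Longrightarrow> skein_eq b y x"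
  using skein.span_neg[of "x - y" "skein_relations b"] by (simp add: skein_eq_def)

lemma skein_eq_trans [trans]: "skein_eq b x y \<Longrightarrow> skein_eq b y z \<Longrightarrow> skein_eq b x z"
  using skein.span_add[of "x - y" "skein_relations b" "y - z"] by (simp add: skein_eq_def)

lemma skein_eq_add: "skein_eq b x x' \<Longrightarrow> skein_eq b y y' \<Longrightarrow> skein_eq b (x + y) (x' + y')"
  using skein.span_add[of "x - x'" "skein_relations b" "y - y'"]
  by (simp add: skein_eq_def add_diff_add)

lemma skein_eq_smul: "skein_eq b x x' \<Longrightarrow> skein_eq b (smul c x) (smul c x')"
  using skein.span_scale[of "x - x'" "skein_relations b" c]
  by (simp add: skein_eq_def skein.scale_right_diff_distrib)

lemma skein_eq_diff: "skein_eq b x x' \<Longrightarrow> skein_eq b y y' \<Longrightarrow> skein_eq b (x - y) (x' - y')"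
  using skein.span_diff[of "x - x'" "skein_relations b" "y - y'"]
  by (simp add: skein_eq_def algebra_simps)

text \<open>The word \<open>w\<^sub>0\<close> fixes one well-formed filling and thereby the
  boundary; \<open>plug_tangles\<close> transfers both to every filling by local crossings.\<close>

locale quadruple_skein =
  fixes Q :: quadruple and b :: boundary_type and w\<^sub>0 :: "nat list"
  assumes positive: "positive_quadruple Q"
    and w\<^sub>0: "set w\<^sub>0 \<subseteq> {1, 2, 3}"
    and wf: "wf_diagram (insert_braid Q w\<^sub>0)"
    and b: "b = boundary_type (insert_braid Q w\<^sub>0)"
begin

abbreviation braid :: "nat list \<Rightarrow> skein_element" where
  "braid w \<equiv> gen (insert_braid Q w)"

lemma plug_tangles: "local_crossings Q cs \<Longrightarrow> plug Q cs \<in> tangles b"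
  using wf_diagram_plug[OF positive local_crossings_braid_slices[OF w\<^sub>0]]
    boundary_type_plug[OF positive local_crossings_braid_slices[OF w\<^sub>0]] wf b
  by (simp add: tangles_def insert_braid_plug)

lemma local_move_skein_eq:
  assumes "local_move cs cs'" "local_crossings Q (xs @ cs @ ys)" "local_crossings Q (xs @ cs' @ ys)"
  shows "skein_eq b (gen (plug Q (xs @ cs @ ys))) (gen (plug Q (xs @ cs' @ ys)))"
proof -
  have "isotopy_step (Diagram (q_top Q) ((above Q @ xs) @ cs @ (ys @ below Q)))
      (Diagram (q_top Q) ((above Q @ xs) @ cs' @ (ys @ below Q)))"
    using plug_tangles[OF assms(2)] plug_tangles[OF assms(3)]
    by (intro isotopy_step.intros assms(1)) (simp_all add: tangles_def plug_def)
  then have "regularly_isotopic (plug Q (xs @ cs @ ys)) (plug Q (xs @ cs' @ ys))"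
    unfolding regularly_isotopic_def plug_def by (simp add: r_into_equivclp)
  then show ?thesis
    unfolding skein_eq_def
    by (intro skein.span_base skein_relations.isotopy plug_tangles[OF assms(2)])
qed

lemma local_move_braid:
  assumes "local_move (braid_slices Q w) (braid_slices Q w')"
    and "set x \<union> set w \<union> set w' \<union> set y \<subseteq> {1, 2, 3}"
  shows "skein_eq b (braid (x @ w @ y)) (braid (x @ w' @ y))"
  using local_move_skein_eq[OF assms(1), of "braid_slices Q x" "braid_slices Q y"] assms(2)
  by (simp add: insert_braid_plug local_crossings_braid_slices)

text \<open>Reidemeister III with all flags \<open>True\<close>, which is one of the non-cyclic
  height orders.\<close>

lemma braid_relation:
  assumes "set (x @ y) \<subseteq> {1, 2, 3}"
  shows "skein_eq b (braid (x @ [1, 2, 1] @ y)) (braid (x @ [2, 1, 2] @ y))"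
    and "skein_eq b (braid (x @ [2, 3, 2] @ y)) (braid (x @ [3, 2, 3] @ y))"
proof -
  have "local_move (braid_slices Q [1, 2, 1]) (braid_slices Q [2, 1, 2])"
    "local_move (braid_slices Q [2, 3, 2]) (braid_slices Q [3, 2, 3])"
    using local_move.R3[of True True True "shift Q"] local_move.R3[of True True True "shift Q + 1"]
    by (simp_all add: braid_slices_def)
  then show "skein_eq b (braid (x @ [1, 2, 1] @ y)) (braid (x @ [2, 1, 2] @ y))"
    "skein_eq b (braid (x @ [2, 3, 2] @ y)) (braid (x @ [3, 2, 3] @ y))"
    using assms by (auto intro!: local_move_braid simp del: append.simps)
qed

lemma far_commutation:
  assumes "set (x @ y) \<subseteq> {1, 2, 3}"
  shows "skein_eq b (braid (x @ [1, 3] @ y)) (braid (x @ [3, 1] @ y))"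
proof -
  have "local_move (braid_slices Q [1, 3]) (braid_slices Q [3, 1])"
    using local_move.far[of "Cross (shift Q) True" "Cross (shift Q + 2) True"]
    by (simp add: braid_slices_def)
  then show ?thesis
    using assms by (intro local_move_braid) auto
qed

text \<open>The skein relation is applied to the second crossing. Its strands are parallel, so the
  smoothing deletes it; switching it leaves a pair that Reidemeister II cancels.\<close>

lemma quadratic_relation:
  assumes "set (x @ y) \<subseteq> {1, 2, 3}" "i \<in> {1, 2, 3}"
  shows "skein_eq b (braid (x @ [i, i] @ y)) (braid (x @ y) + smul laurent_z (braid (x @ [i] @ y)))"
proof -
  define j where "j = i - 1"
  have j: "j < 3"
    using assms(2) by (auto simp: j_def)
  let ?X = "braid_slices Q x" and ?Y = "braid_slices Q y"
  let ?c = "Cross (shift Q + j)"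
  have xy: "local_crossings Q ?X" "local_crossings Q ?Y"
    using assms by (intro local_crossings_braid_slices; auto)+
  have c: "local_crossings Q [?c h]" for h
    using j by (auto simp: local_crossings_def)
  have lc: "local_crossings Q (?X @ [?c True, ?c h] @ ?Y)" for h
    using xy c[of True] c[of h] by (auto simp: local_crossings_def)
  have mid: "fold act (above Q @ ?X @ [?c True]) (q_top Q) = middle_word Q"
    using local_crossings_middle(1)[OF positive, of "?X @ [?c True]"] xy c
    by (simp add: middle_word_def)
  have down: "middle_word Q ! (shift Q + j) = middle_word Q ! (shift Q + j + 1)"
    using middle_word_Down[OF positive, of j] middle_word_Down[OF positive, of "j + 1"] j
    by (simp add: add.assoc)
  \<comment> \<open>The prefix contains the first of the two crossings, so that the one resolved is
    the second.\<close>
  define P where "P = above Q @ ?X @ [?c True]"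
  have P: "plug Q (?X @ ?c True # cs @ ?Y) = Diagram (q_top Q) (P @ cs @ ?Y @ below Q)" for cs
    by (simp add: plug_def P_def)
  have "gen (Diagram (q_top Q) (P @ ?c True # ?Y @ below Q))
      - gen (Diagram (q_top Q) (P @ ?c (\<not> True) # ?Y @ below Q))
      - smul laurent_z (gen (Diagram (q_top Q)
          (P @ smoothing (fold act P (q_top Q)) (shift Q + j) @ ?Y @ below Q)))
      \<in> skein_relations b"
    using plug_tangles[OF lc[of True]] P[of "[?c True]"] mid down
    by (intro skein_relations.crossing) (simp_all add: P_def[symmetric])
  then have "gen (plug Q (?X @ [?c True, ?c True] @ ?Y)) - gen (plug Q (?X @ [?c True, ?c False] @ ?Y))
      - smul laurent_z (gen (plug Q (?X @ [?c True] @ ?Y))) \<in> skein_relations b"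
    using P[of "[?c True]"] P[of "[?c False]"] P[of "[]"] mid down
    by (simp add: P_def[symmetric] smoothing_def)
  then have 1: "skein_eq b (gen (plug Q (?X @ [?c True, ?c True] @ ?Y)))
      (gen (plug Q (?X @ [?c True, ?c False] @ ?Y)) + smul laurent_z (gen (plug Q (?X @ [?c True] @ ?Y))))"
    unfolding skein_eq_def by (simp add: diff_diff_eq skein.span_base)
  have "skein_eq b (gen (plug Q (?X @ [?c True, ?c False] @ ?Y))) (gen (plug Q (?X @ [] @ ?Y)))"
    using local_move.R2[of "shift Q + j" True] xy
    by (intro local_move_skein_eq lc) auto
  from skein_eq_trans[OF 1 skein_eq_add[OF this skein_eq_refl]]
  show ?thesis
    by (simp add: insert_braid_plug braid_slices_def j_def)
qed

end


section \<open>Passing the branches of the quadruple crossing\<close>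

definition swap_at :: "nat \<Rightarrow> 'a list \<Rightarrow> 'a list" where
  "swap_at i bs = bs[i - 1 := bs ! i, i := bs ! (i - 1)]"

definition arrangement :: "nat list \<Rightarrow> nat \<Rightarrow> nat list" where
  "arrangement w l = fold swap_at (take l w) [0, 1, 2, 3]"

text \<open>Six letters reversing four branches form a reduced word of the longest permutation, so
  each pair of branches crosses exactly once.\<close>

definition half_twist :: "nat list \<Rightarrow> bool" where
  "half_twist w \<longleftrightarrow> set w \<subseteq> {1, 2, 3} \<and> length w = 6 \<and> arrangement w 6 = [3, 2, 1, 0]"

lemma arrangement_0 [simp]: "arrangement w 0 = [0, 1, 2, 3]"
  by (simp add: arrangement_def)

lemma arrangement_Suc: "l < length w \<Longrightarrow> arrangement w (Suc l) = swap_at (w ! l) (arrangement w l)"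
  by (simp add: arrangement_def take_Suc_conv_app_nth)

lemma arrangement_perm:
  assumes "set w \<subseteq> {1, 2, 3}"
  shows "length (arrangement w l) = 4 \<and> distinct (arrangement w l) \<and> set (arrangement w l) = {..<4}"
proof -
  have "length (fold swap_at v bs) = 4 \<and> distinct (fold swap_at v bs) \<and> set (fold swap_at v bs) = {..<4}"
    if "set v \<subseteq> {1, 2, 3}" "length bs = 4 \<and> distinct bs \<and> set bs = {..<4}" for v and bs :: "nat list"
    using that
  proof (induction v arbitrary: bs)
    case (Cons i v)
    then have "length (swap_at i bs) = 4 \<and> distinct (swap_at i bs) \<and> set (swap_at i bs) = {..<4}"
      by (auto simp: swap_at_def distinct_swap set_swap)
    with Cons show ?case
      by simp
  qed simp
  moreover have "set (take l w) \<subseteq> {1, 2, 3}"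
    using assms set_take_subset[of l w] by blast
  moreover have "length [0, 1, 2, 3 :: nat] = 4 \<and> distinct [0, 1, 2, 3 :: nat] \<and> set [0, 1, 2, 3 :: nat] = {..<4}"
    by auto
  ultimately show ?thesis
    unfolding arrangement_def by blast
qed

lemma arrangement_less: "set w \<subseteq> {1, 2, 3} \<Longrightarrow> j < 4 \<Longrightarrow> arrangement w l ! j < 4"
  using arrangement_perm[of w l] nth_mem[of j "arrangement w l"] by auto

lemma arrangement_inj:
  "set w \<subseteq> {1, 2, 3} \<Longrightarrow> i < 4 \<Longrightarrow> j < 4 \<Longrightarrow> arrangement w l ! i = arrangement w l ! j \<longleftrightarrow> i = j"
  using arrangement_perm[of w l] by (simp add: nth_eq_iff_index_eq)

lemma arrangement_surj:
  assumes "set w \<subseteq> {1, 2, 3}" "c < 4"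
  obtains j where "j < 4" "arrangement w l ! j = c"
  using arrangement_perm[OF assms(1), of l] assms(2) by (metis in_set_conv_nth lessThan_iff)

lemma fst_through_down: "fst (through_down c (i, j)) = i \<or> fst (through_down c (i, j)) = i + 1"
  by (cases c) auto

lemma fst_through_up: "fst (through_up c (i, j)) = i \<or> fst (through_up c (i, j)) = i - 1"
  by (cases c) auto

lemma through_beside:
  assumes "c \<in> {1, 2, 3}" "\<not> (k \<le> j \<and> j < k + 4)"
  shows "through_down (Cross (k + (c - 1)) h) (i, j) = (i + 1, j)"
    "through_up (Cross (k + (c - 1)) h) (i, j) = (i - 1, j)"
proof -
  have "j \<noteq> k + (c - 1)" "j \<noteq> k + (c - 1) + 1"
    using assms by auto
  then show "through_down (Cross (k + (c - 1)) h) (i, j) = (i + 1, j)"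
    "through_up (Cross (k + (c - 1)) h) (i, j) = (i - 1, j)"
    by simp_all
qed

section \<open>Comparing the circles of different words\<close>

locale closed_quadruple =
  fixes Q :: quadruple and \<sigma> :: "bpoint \<Rightarrow> bpoint" and base :: bpoint
    and w\<^sub>0 :: "nat list"
  assumes positive: "positive_quadruple Q"
    and w\<^sub>0: "half_twist w\<^sub>0"
    and wf: "wf_diagram (insert_braid Q w\<^sub>0)"
    and closure: "abstract_closure (insert_braid Q w\<^sub>0) \<sigma>"
    and base: "base \<in> bpoints (insert_braid Q w\<^sub>0)"
begin

abbreviation diagram_of :: "nat list \<Rightarrow> diagram" where
  "diagram_of w \<equiv> insert_braid Q w"

abbreviation T :: diagram where
  "T \<equiv> diagram_of w\<^sub>0"

abbreviation first_level :: nat where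
  "first_level \<equiv> length (above Q)"

text \<open>The line \<open>first_level + 6\<close> is left out: there all words have brought the
  branches to the same outgoing positions.\<close>

definition inside :: "point \<Rightarrow> bool" where
  "inside x \<longleftrightarrow> first_level \<le> fst x \<and> fst x < first_level + 6 \<and> shift Q \<le> snd x \<and> snd x < shift Q + 4"

lemma insideE:
  assumes "inside x"
  obtains l j where "x = (first_level + l, shift Q + j)" "l < 6" "j < 4"
proof (rule that[of "fst x - first_level" "snd x - shift Q"])
qed (use assms in \<open>auto simp: inside_def prod_eq_iff\<close>)

lemma inside_block [simp]: "l < 6 \<Longrightarrow> j < 4 \<Longrightarrow> inside (first_level + l, shift Q + j)"
  by (simp add: inside_def)

text \<open>
  All words of the meridian permute the four branches in the same way, so that their diagrams agree
  outside the quadruple crossing. \<open>relabel w\<close> straightens the four branches (branch \<open>c\<close> is put at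
  the position \<open>c\<close> on each of the first six lines) and thus conjugates the circle of every word to
  the one map \<open>model_step\<close>, which makes passage times independent of the word. Branches
  are numbered from 0.
\<close>

definition relabel :: "nat list \<Rightarrow> point \<Rightarrow> point" where
  "relabel w x = (if inside x
     then (fst x, shift Q + arrangement w (fst x - first_level) ! (snd x - shift Q)) else x)"

definition model_step :: "point \<Rightarrow> point" where
  "model_step x = (if inside x
     then (if fst x = first_level + 5 then (fst x + 1, shift Q + (3 - (snd x - shift Q)))
           else (fst x + 1, snd x))
     else circle_step T \<sigma> x)"

lemma relabel_block [simp]:
  "l < 6 \<Longrightarrow> j < 4 \<Longrightarrow>
    relabel w (first_level + l, shift Q + j) = (first_level + l, shift Q + arrangement w l ! j)"
  by (simp add: relabel_def)

lemma relabel_outside: "\<not> inside x \<Longrightarrow> relabel w x = x"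
  by (simp add: relabel_def)

text \<open>On the first line of the block the arrangement is still the identity.\<close>

lemma relabel_first: "fst x \<le> first_level \<Longrightarrow> relabel w x = x"
proof (cases "inside x")
  case True
  assume "fst x \<le> first_level"
  moreover from True obtain l j where x: "x = (first_level + l, shift Q + j)" "l < 6" "j < 4"
    by (rule insideE)
  ultimately have "l = 0" "j = 0 \<or> j = 1 \<or> j = 2 \<or> j = 3"
    by auto
  then show ?thesis
    using x relabel_block[of 0 j w] by auto
qed (simp add: relabel_outside)

lemma relabel_last: "first_level + 6 \<le> fst x \<Longrightarrow> relabel w x = x"
  by (simp add: relabel_outside inside_def)

lemma relabel_inj:
  assumes "set w \<subseteq> {1, 2, 3}"
  shows "relabel w x = relabel w y \<longleftrightarrow> x = y"
proof
  assume eq: "relabel w x = relabel w y"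
  have ins: "inside (relabel w z) \<longleftrightarrow> inside z" for z
    by (cases "inside z") (auto elim!: insideE simp: arrangement_less[OF assms] relabel_outside)
  show "x = y"
  proof (cases "inside x")
    case True
    moreover from this have "inside y"
      using ins eq by metis
    ultimately show ?thesis
      using eq by (auto elim!: insideE simp: arrangement_inj[OF assms])
  next
    case False
    moreover from this have "\<not> inside y"
      using ins eq by metis
    ultimately show ?thesis
      using eq by (simp add: relabel_outside)
  qed
qed simp

context
  fixes w :: "nat list"
  assumes w: "half_twist w"
begin

lemma letters: "set w \<subseteq> {1, 2, 3}"
  and length_w: "length w = 6"
  using w by (auto simp: half_twist_def)

lemma length_slices: "length (slices (diagram_of w)) = first_level + 6 + length (below Q)"
  by (simp add: insert_braid_def length_w)

lemma letter: "l < 6 \<Longrightarrow> w ! l \<in> {1, 2, 3}"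
  using letters length_w nth_mem[of l w] by (simp add: subset_iff)

lemma slices_block: "l < 6 \<Longrightarrow> slices (diagram_of w) ! (first_level + l) = Cross (shift Q + (w ! l - 1)) True"
  by (simp add: insert_braid_def nth_append length_w)

end

context
  fixes w :: "nat list"
  assumes w: "half_twist w"
begin

text \<open>The previous context is closed so that its facts apply to both \<open>w\<close> and
  \<open>w\<^sub>0\<close>, which are compared from here on. Both have six letters, so slices
  outside the block keep their indices.\<close>

lemma slices_other:
  "\<not> (first_level \<le> i \<and> i < first_level + 6) \<Longrightarrow> slices (diagram_of w) ! i = slices T ! i"
  by (auto simp: insert_braid_def nth_append length_w[OF w] length_w[OF w\<^sub>0])

lemma level_diagram_of: "level (diagram_of w) i = level T i"
  using letters[OF w] letters[OF w\<^sub>0]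
  by (simp add: insert_braid_plug level_plug positive local_crossings_braid_slices
      length_w[OF w] length_w[OF w\<^sub>0])

lemma level_block: "l \<le> 6 \<Longrightarrow> level (diagram_of w) (first_level + l) = middle_word Q"
  using letters[OF w] letters[OF w\<^sub>0]
  by (simp add: insert_braid_plug level_plug positive local_crossings_braid_slices length_w[OF w]
      middle_word_def)

lemma level_block_Down: "l \<le> 6 \<Longrightarrow> j < 4 \<Longrightarrow> level (diagram_of w) (first_level + l) ! (shift Q + j) = Down"
  using level_block middle_word_Down[OF positive] by simp

lemma bpoint_point_diagram_of: "bpoint_point (diagram_of w) e = bpoint_point T e"
  by (cases e) (simp_all add: insert_braid_def length_w[OF w] length_w[OF w\<^sub>0])

lemma relabel_bpoint: "relabel w (bpoint_point T e) = bpoint_point T e"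
  by (cases e) (simp_all add: relabel_first relabel_outside inside_def insert_braid_def
      length_w[OF w\<^sub>0])

lemma bpoints_diagram_of: "bpoints (diagram_of w) = bpoints T"
  using boundary_type_plug[OF positive local_crossings_braid_slices[OF letters[OF w]]
      local_crossings_braid_slices[OF letters[OF w\<^sub>0]]]
  by (simp add: bpoints_def starts_def ends_def boundary_type_def insert_braid_plug)

text \<open>\<open>j'\<close> is the position to which the letter moves the strand at
  \<open>j\<close>; the branch travels with it.\<close>

lemma block_nth:
  assumes "l < 6" "j < 4"
  defines "j' \<equiv> if j = w ! l - 1 then w ! l else if j = w ! l then w ! l - 1 else j"
  shows "arrangement w (Suc l) ! j' = arrangement w l ! j" "j' < 4"
proof -
  have len: "length (arrangement w l) = 4"
    using arrangement_perm[OF letters[OF w]] by blast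
  have "w ! l = 1 \<or> w ! l = 2 \<or> w ! l = 3"
    using letter[OF w assms(1)] by simp
  then show "arrangement w (Suc l) ! j' = arrangement w l ! j" "j' < 4"
    using assms(1,2) by (auto simp: j'_def arrangement_Suc length_w[OF w] swap_at_def len)
qed

lemma circle_step_block:
  assumes "l < 6" "j < 4"
  shows "circle_step (diagram_of w) \<sigma> (first_level + l, shift Q + j) =
    (first_level + l + 1,
     shift Q + (if j = w ! l - 1 then w ! l else if j = w ! l then w ! l - 1 else j))"
  using letter[OF w assms(1)] assms
  by (auto simp: circle_step_def level_block_Down length_slices[OF w] slices_block[OF w] simp del: One_nat_def)

text \<open>Strands beside the block run straight past its crossings. Since the four branches point
  down, the block is entered only through its first line, where relabelling is trivial.\<close>

lemma circle_step_outside: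
  assumes "\<not> inside x"
  shows "circle_step (diagram_of w) \<sigma> x = circle_step T \<sigma> x"
    "relabel w (circle_step (diagram_of w) \<sigma> x) = circle_step (diagram_of w) \<sigma> x"
proof -
  obtain i j where x: "x = (i, j)"
    by (cases x)
  have N: "length (slices (diagram_of w)) = length (slices T)"
    by (simp add: insert_braid_def length_w[OF w] length_w[OF w\<^sub>0])
  have "circle_step (diagram_of w) \<sigma> x = circle_step T \<sigma> x \<and>
    relabel w (circle_step (diagram_of w) \<sigma> x) = circle_step (diagram_of w) \<sigma> x"
  proof (cases "level T i ! j")
    case Down
    show ?thesis
    proof (cases "i = length (slices T)")
      case True
      then show ?thesis
        using Down by (simp add: circle_step_def x level_diagram_of N bpoint_point_diagram_of relabel_bpoint flip: True)
    next
      case False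
      then have step: "circle_step (diagram_of w) \<sigma> x = through_down (slices (diagram_of w) ! i) (i, j)"
        "circle_step T \<sigma> x = through_down (slices T ! i) (i, j)"
        by (simp_all add: circle_step_def x Down level_diagram_of N)
      show ?thesis
      proof (cases "first_level \<le> i \<and> i < first_level + 6")
        case True
        then obtain l where l: "i = first_level + l" "l < 6"
          using le_Suc_ex[of first_level] by auto
        then have j: "\<not> (shift Q \<le> j \<and> j < shift Q + 4)"
          using assms by (auto simp: x inside_def)
        show ?thesis
          unfolding step l(1) slices_block[OF w l(2)] slices_block[OF w\<^sub>0 l(2)]
            through_beside(1)[OF letter[OF w l(2)] j] through_beside(1)[OF letter[OF w\<^sub>0 l(2)] j]
          using j by (simp add: relabel_outside inside_def)
      next
        case out: False
        then show ?thesis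
          using fst_through_down[of "slices T ! i" i j]
          unfolding step slices_other[OF out]
          by (cases "i < first_level") (force intro: relabel_first relabel_last)+
      qed
    qed
  next
    case Up
    show ?thesis
    proof (cases "i = 0")
      case True
      then show ?thesis
        using Up by (simp add: circle_step_def x level_diagram_of N bpoint_point_diagram_of relabel_bpoint)
    next
      case False
      then have step: "circle_step (diagram_of w) \<sigma> x = through_up (slices (diagram_of w) ! (i - 1)) (i, j)"
        "circle_step T \<sigma> x = through_up (slices T ! (i - 1)) (i, j)"
        by (simp_all add: circle_step_def x Up level_diagram_of N)
      show ?thesis
      proof (cases "first_level \<le> i - 1 \<and> i - 1 < first_level + 6")
        case True
        then obtain l where l: "i - 1 = first_level + l" "l < 6"
          using le_Suc_ex[of first_level] by auto
        \<comment> \<open>A step up uses the slice above the current line, so block slices are met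
          from the lines \<open>first_level + 1\<close> to \<open>first_level + 6\<close>. Hence
          \<open>level_block_Down\<close> is used with \<open>Suc l\<close>, including the line
          below the block.\<close>
        then have i: "i = first_level + Suc l"
          using False by simp
        have j: "\<not> (shift Q \<le> j \<and> j < shift Q + 4)"
        proof
          assume "shift Q \<le> j \<and> j < shift Q + 4"
          then have "j - shift Q < 4" "shift Q + (j - shift Q) = j"
            by auto
          then show False
            using level_block_Down[of "Suc l" "j - shift Q"] Up l by (simp add: i level_diagram_of)
        qed
        show ?thesis
          unfolding step l(1) slices_block[OF w l(2)] slices_block[OF w\<^sub>0 l(2)]
            through_beside(2)[OF letter[OF w l(2)] j] through_beside(2)[OF letter[OF w\<^sub>0 l(2)] j]
          using j by (simp add: relabel_outside inside_def)
      next
        case out: False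
        then show ?thesis
          using fst_through_up[of "slices T ! (i - 1)" i j] False
          unfolding step slices_other[OF out]
          by (cases "i \<le> first_level") (force intro: relabel_first relabel_last)+
      qed
    qed
  qed
  then show "circle_step (diagram_of w) \<sigma> x = circle_step T \<sigma> x"
    "relabel w (circle_step (diagram_of w) \<sigma> x) = circle_step (diagram_of w) \<sigma> x"
    by blast+
qed

lemma relabel_circle_step: "relabel w (circle_step (diagram_of w) \<sigma> x) = model_step (relabel w x)"
proof (cases "inside x")
  case True
  then obtain l j where x: "x = (first_level + l, shift Q + j)" "l < 6" "j < 4"
    by (rule insideE)
  define j' where "j' = (if j = w ! l - 1 then w ! l else if j = w ! l then w ! l - 1 else j)"
  have j': "arrangement w (Suc l) ! j' = arrangement w l ! j" "j' < 4"
    using block_nth[OF x(2,3)] by (simp_all add: j'_def)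
  have step: "circle_step (diagram_of w) \<sigma> x = (first_level + Suc l, shift Q + j')"
    using circle_step_block[OF x(2,3)] by (simp add: x(1) j'_def)
  have a: "arrangement w l ! j < 4"
    using arrangement_less[OF letters[OF w] x(3)] .
  show ?thesis
  proof (cases "l = 5")
    case True
    \<comment> \<open>After the sixth letter the arrangement is reversed, so branch \<open>c\<close>
      leaves at position \<open>3 - c\<close> for every word.\<close>
    have "j' \<in> {0, 1, 2, 3}"
      using j' by auto
    moreover have "[3, 2, 1, 0] ! j' = arrangement w l ! j"
      using w j'(1) True by (simp add: half_twist_def)
    ultimately have "j' = 3 - arrangement w l ! j"
      by auto
    then show ?thesis
      unfolding step using True x a by (simp add: model_step_def relabel_outside inside_def)
  next
    case False
    then show ?thesis
      unfolding step using x a j' relabel_block[of "Suc l" j' w] by (simp add: model_step_def inside_def)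
  qed
next
  case False
  then show ?thesis
    using circle_step_outside[OF False] by (simp add: model_step_def relabel_outside)
qed

end

end


section \<open>Passage times\<close>

context closed_quadruple
begin

definition base_point :: point where
  "base_point = bpoint_point T base"

definition model_time :: "point \<Rightarrow> nat" where
  "model_time x = (LEAST m. (model_step ^^ m) base_point = x)"

definition reachable :: "point \<Rightarrow> bool" where
  "reachable x \<longleftrightarrow> (\<exists>m. (model_step ^^ m) base_point = x)"

lemma relabel_funpow:
  "half_twist w \<Longrightarrow> relabel w ((circle_step (diagram_of w) \<sigma> ^^ m) x) = (model_step ^^ m) (relabel w x)"
  by (induction m) (simp_all add: relabel_circle_step)

text \<open>Relabelling is injective, fixes the base point and conjugates the circle to
  \<open>model_step\<close>. So the same iterates hit the point, and the least one agrees.\<close>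

lemma time_diagram_of:
  assumes "half_twist w"
  shows "time (diagram_of w) \<sigma> base x = model_time (relabel w x)"
proof -
  have "(circle_step (diagram_of w) \<sigma> ^^ m) base_point = x \<longleftrightarrow>
      (model_step ^^ m) base_point = relabel w x" for m
    using relabel_funpow[OF assms, of m base_point] relabel_inj[OF letters[OF assms]]
      relabel_bpoint[OF assms, of base]
    unfolding base_point_def by metis
  then show ?thesis
    by (simp add: time_def model_time_def bpoint_point_diagram_of[OF assms] flip: base_point_def)
qed

lemma bpoint_point_points: "e \<in> bpoints T \<Longrightarrow> bpoint_point T e \<in> points T"
  by (auto simp: bpoints_def starts_def ends_def points_def bottom_word_def level_def)

lemma block_points:
  assumes "l \<le> 6" "j < 4"
  shows "(first_level + l, shift Q + j) \<in> points T"
  using assms middle_word_Down[OF positive]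
  by (simp add: points_def level_block[OF w\<^sub>0] length_slices[OF w\<^sub>0])

lemma reachable_points:
  assumes "x \<in> points T"
  shows "reachable (relabel w\<^sub>0 x)"
proof -
  obtain m where "(circle_step T \<sigma> ^^ m) base_point = x"
    using closure assms bpoint_point_points[OF base]
    unfolding abstract_closure_def base_point_def by blast
  then have "(model_step ^^ m) base_point = relabel w\<^sub>0 x"
    using relabel_funpow[OF w\<^sub>0, of m base_point] relabel_bpoint[OF w\<^sub>0]
    by (simp add: base_point_def)
  then show ?thesis
    by (auto simp: reachable_def)
qed

lemma reachable_outside: "x \<in> points T \<Longrightarrow> \<not> inside x \<Longrightarrow> reachable x"
  using reachable_points[of x] by (simp add: relabel_outside)

lemma reachable_block:
  assumes "l < 6" "c < 4"
  shows "reachable (first_level + l, shift Q + c)"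
proof -
  obtain j where "j < 4" "arrangement w\<^sub>0 l ! j = c"
    using arrangement_surj[OF letters[OF w\<^sub>0] assms(2)] .
  then show ?thesis
    using reachable_points[OF block_points[of l j]] assms by simp
qed

lemma funpow_model_time: "reachable x \<Longrightarrow> (model_step ^^ model_time x) base_point = x"
  unfolding reachable_def model_time_def by (rule LeastI_ex)

lemma model_time_inj:
  "reachable x \<Longrightarrow> reachable y \<Longrightarrow> model_time x = model_time y \<longleftrightarrow> x = y"
  using funpow_model_time by metis

lemma model_time_le: "(model_step ^^ m) base_point = x \<Longrightarrow> model_time x \<le> m"
  unfolding model_time_def by (rule Least_le)

text \<open>Transitivity of the circle alone would allow zero steps. One explicit step at a corner
  of the block, whose result is known to be a point of the diagram, makes the return time
  positive.\<close>

lemma returns_to_base: "\<exists>n. (model_step ^^ Suc n) base_point = base_point"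
proof -
  define x where "x = (first_level, shift Q)"
  have x: "relabel w\<^sub>0 x = x" "x \<in> points T"
    using block_points[of 0 0] by (simp_all add: x_def relabel_first)
  obtain m where m: "(circle_step T \<sigma> ^^ m) base_point = x"
    using closure x(2) bpoint_point_points[OF base]
    unfolding abstract_closure_def base_point_def by blast
  have y: "circle_step T \<sigma> x \<in> points T"
  proof -
    have "w\<^sub>0 ! 0 \<in> {1, 2, 3}"
      using letter[OF w\<^sub>0, of 0] by simp
    then have "(if 0 = w\<^sub>0 ! 0 - 1 then w\<^sub>0 ! 0 else if 0 = w\<^sub>0 ! 0 then w\<^sub>0 ! 0 - 1 else 0) < (4 :: nat)"
      by auto
    from block_points[of 1, OF _ this] show ?thesis
      using circle_step_block[OF w\<^sub>0, of 0 0] by (simp add: x_def)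
  qed
  obtain k where k: "(circle_step T \<sigma> ^^ k) (circle_step T \<sigma> x) = base_point"
    using closure y bpoint_point_points[OF base]
    unfolding abstract_closure_def base_point_def by blast
  have "(circle_step T \<sigma> ^^ Suc (k + m)) base_point = base_point"
    using k m by (simp add: funpow_swap1 funpow_add)
  then have "(model_step ^^ Suc (k + m)) base_point = base_point"
    using relabel_funpow[OF w\<^sub>0, of "Suc (k + m)" base_point] relabel_bpoint[OF w\<^sub>0, of base]
    by (metis base_point_def)
  then show ?thesis
    by blast
qed

text \<open>The orbit is periodic, hence \<open>model_step\<close> is injective on it and the point
  met just before \<open>model_step x\<close> is \<open>x\<close>. The base point is excluded
  because its time is 0.\<close>

lemma model_time_step:
  assumes "reachable x" "model_step x \<noteq> base_point"
  shows "model_time (model_step x) = Suc (model_time x)"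
proof -
  obtain n where n: "(model_step ^^ Suc n) base_point = base_point"
    using returns_to_base by blast
  have period: "(model_step ^^ Suc n) y = y" if "reachable y" for y
  proof -
    from that obtain m where y: "y = (model_step ^^ m) base_point"
      by (auto simp: reachable_def)
    have "(model_step ^^ Suc n) y = (model_step ^^ (Suc n + m)) base_point"
      by (simp only: y funpow_add comp_apply)
    also have "\<dots> = (model_step ^^ m) ((model_step ^^ Suc n) base_point)"
      by (simp only: funpow_add comp_apply add.commute[of "Suc n" m])
    finally show ?thesis
      by (simp only: n y)
  qed
  have reach: "reachable (model_step x)"
    using funpow_model_time[OF assms(1)] unfolding reachable_def
    by (intro exI[of _ "Suc (model_time x)"]) simp
  define k where "k = model_time (model_step x)"
  have k: "(model_step ^^ k) base_point = model_step x"
    unfolding k_def by (rule funpow_model_time[OF reach])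
  obtain k' where k': "k = Suc k'"
    using k assms(2) by (cases k) auto
  let ?y = "(model_step ^^ k') base_point"
  have "model_step ?y = model_step x"
    using k k' by simp
  \<comment> \<open>Equal images stay equal for a full period, after which each point has returned
    to itself.\<close>
  then have "(model_step ^^ Suc n) ?y = (model_step ^^ Suc n) x"
    by (simp only: funpow_Suc_right comp_apply)
  moreover have "reachable ?y"
    by (auto simp: reachable_def)
  ultimately have "?y = x"
    by (simp only: period assms(1))
  then have "model_time x \<le> k'"
    by (rule model_time_le)
  moreover have "k \<le> Suc (model_time x)"
    unfolding k_def using funpow_model_time[OF assms(1)] by (intro model_time_le) simp
  ultimately show ?thesis
    using k' by (simp add: k_def)
qed

section \<open>Passage times of the four branches\<close>

definition branch_time :: "nat \<Rightarrow> nat" where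
  "branch_time c = model_time (first_level, shift Q + c)"

lemma model_time_block:
  assumes "l < 6" "c < 4"
  shows "model_time (first_level + l, shift Q + c) = branch_time c + l"
  using assms(1)
proof (induction l)
  case (Suc l)
  let ?x = "(first_level + l, shift Q + c)"
  have step: "model_step ?x = (first_level + Suc l, shift Q + c)"
    using Suc.prems assms(2) by (simp add: model_step_def)
  \<comment> \<open>Boundary points lie on the first or the last line of the diagram, so the count
    cannot restart at a later line of the block.\<close>
  have "bpoint_point T base \<noteq> (first_level + Suc l, shift Q + c)"
    using Suc.prems by (cases base) (auto simp: length_slices[OF w\<^sub>0])
  then have "base_point \<noteq> (first_level + Suc l, shift Q + c)"
    by (simp add: base_point_def)
  then show ?case
    using model_time_step[of ?x] reachable_block[of l c] Suc assms(2) by (simp only: step) simp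
qed (simp add: branch_time_def)

lemma branch_time_neq:
  assumes "c < 4" "c' < 4" "c \<noteq> c'" "l < 6" "l' < 6"
  shows "branch_time c + l \<noteq> branch_time c' + l'"
  using model_time_inj[OF reachable_block[of l c] reachable_block[of l' c']] assms
  by (simp add: model_time_block)

text \<open>Each branch occupies six consecutive times, and these runs are disjoint for different
  branches. Hence their points compare as the entries do.\<close>

lemma branch_time_less:
  assumes "c < 4" "c' < 4" "c \<noteq> c'" "l < 6" "l' < 6"
  shows "branch_time c + l < branch_time c' + l' \<longleftrightarrow> branch_time c < branch_time c'"
proof -
  have neq: "branch_time c + l \<noteq> branch_time c' + i" if "i < 6" for i
    using branch_time_neq assms that by simp
  have neq': "branch_time c + i \<noteq> branch_time c'" if "i < 6" for i
    using branch_time_neq[of c c' i 0] assms that by simp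
  show ?thesis
    \<comment> \<open>If the comparisons disagreed, one of these two differences would be an index
      below 6 at which the runs share a time.\<close>
    using neq[of "branch_time c + l - branch_time c'"] neq'[of "branch_time c' - branch_time c"] assms
    by linarith
qed

lemma model_time_outside_neq:
  assumes "reachable x" "\<not> inside x" "c < 4" "l < 6"
  shows "model_time x \<noteq> branch_time c + l"
  using model_time_inj[OF assms(1) reachable_block[OF assms(4,3)]] assms(2-4)
  by (auto simp: model_time_block)

lemma model_time_outside_less:
  assumes "reachable x" "\<not> inside x" "c < 4" "l < 6"
  shows "model_time x < branch_time c + l \<longleftrightarrow> model_time x < branch_time c"
  using model_time_outside_neq[OF assms(1-3), of "model_time x - branch_time c"] assms(4) by linarith

lemma time_block:
  assumes "half_twist w" "l < 6" "j < 4"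
  shows "time (diagram_of w) \<sigma> base (first_level + l, shift Q + j) = branch_time (arrangement w l ! j) + l"
  using assms arrangement_less[OF letters[OF assms(1)]]
  by (simp add: time_diagram_of model_time_block)

definition bpoint_time :: "bpoint \<Rightarrow> nat" where
  "bpoint_time e = model_time (bpoint_point T e)"

lemma time_bpoint:
  "half_twist w \<Longrightarrow> time (diagram_of w) \<sigma> base (bpoint_point (diagram_of w) e) = bpoint_time e"
  by (simp add: time_diagram_of bpoint_point_diagram_of relabel_bpoint bpoint_time_def)

text \<open>The first line is excluded by \<open>0 < l\<close>: with no slices above the block, the
  branches start there at boundary points.\<close>

lemma bpoint_time_neq:
  assumes "e \<in> bpoints T" "c < 4" "0 < l" "l < 6"
  shows "bpoint_time e \<noteq> branch_time c + l"
proof -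
  have "bpoint_point T e \<noteq> (first_level + l, shift Q + c)"
    using assms(3,4) by (cases e) (auto simp: length_slices[OF w\<^sub>0])
  moreover have "reachable (bpoint_point T e)"
    using reachable_points[OF bpoint_point_points[OF assms(1)]] relabel_bpoint[OF w\<^sub>0] by simp
  ultimately show ?thesis
    using model_time_inj[OF _ reachable_block[OF assms(4,2)]]
    by (simp add: bpoint_time_def model_time_block[OF assms(4,2)] flip: model_time_block[OF assms(4,2)])
qed

section \<open>Types and gradings of the crossings in the block\<close>

definition branch_grading :: "nat \<Rightarrow> nat \<Rightarrow> bpoint set" where
  "branch_grading c c' = {e \<in> bpoints T. branch_time c' < bpoint_time e \<or> bpoint_time e \<le> branch_time c}"

definition under_branch :: "nat list \<Rightarrow> nat \<Rightarrow> nat" where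
  "under_branch w l = arrangement w l ! (w ! l - 1)"

definition over_branch :: "nat list \<Rightarrow> nat \<Rightarrow> nat" where
  "over_branch w l = arrangement w l ! (w ! l)"

context
  fixes w :: "nat list" and l :: nat
  assumes w: "half_twist w" and l: "l < 6"
begin

lemma letter_cases: "w ! l - 1 < 4" "w ! l < 4" "w ! l - 1 + 1 = w ! l" "w ! l - 1 \<noteq> w ! l"
  using letter[OF w l] by auto

lemma branch_less: "under_branch w l < 4" "over_branch w l < 4" "under_branch w l \<noteq> over_branch w l"
  using arrangement_less[OF letters[OF w]] letter_cases arrangement_inj[OF letters[OF w]]
  by (simp_all add: under_branch_def over_branch_def)

lemma time_under_entry:
  "time (diagram_of w) \<sigma> base (under_entry (diagram_of w) (first_level + l)) = branch_time (under_branch w l) + l"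
  using time_block[OF w l letter_cases(1)] level_block_Down[OF w _ letter_cases(1), of l] l
  by (simp add: under_entry_def falling_entry_def slices_block[OF w l] under_branch_def)

lemma time_over_entry:
  "time (diagram_of w) \<sigma> base (over_entry (diagram_of w) (first_level + l)) = branch_time (over_branch w l) + l"
proof -
  have "shift Q + (w ! l - 1) + 1 = shift Q + w ! l"
    using letter_cases(3) by linarith
  then show ?thesis
    using time_block[OF w l letter_cases(2)] level_block_Down[OF w _ letter_cases(2), of l] l
    by (simp add: over_entry_def rising_entry_def slices_block[OF w l] over_branch_def del: One_nat_def
        Suc_eq_plus1_left add_Suc_right)
qed

lemma type1_block:
  "type1 (diagram_of w) \<sigma> base (first_level + l) \<longleftrightarrow>
    branch_time (under_branch w l) < branch_time (over_branch w l)"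
  by (simp add: type1_def time_under_entry time_over_entry)

text \<open>After the entry of a branch, no boundary point is met until its passage at line
  \<open>l\<close>, so entry times may replace passage times. A boundary point at the entry itself
  counts as preceding the passage in both versions.\<close>

lemma crossing_grading_block:
  "crossing_grading (diagram_of w) \<sigma> base (first_level + l) =
    branch_grading (under_branch w l) (over_branch w l)"
proof -
  have *: "branch_time c + l < bpoint_time e \<longleftrightarrow> branch_time c < bpoint_time e"
    if "e \<in> bpoints T" "c < 4" for c e
    using bpoint_time_neq[OF that, of "bpoint_time e - branch_time c"] l by linarith
  show ?thesis
    using *[OF _ branch_less(1)] *[OF _ branch_less(2)]
    unfolding crossing_grading_def branch_grading_def bpoints_diagram_of[OF w] time_bpoint[OF w]
      time_under_entry time_over_entry
    by (intro Collect_cong) (meson not_less)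
qed

lemma writhe_block: "writhe (diagram_of w) (first_level + l) = 1"
  using level_block_Down[OF w _ letter_cases(1), of l] level_block_Down[OF w _ letter_cases(2), of l] l
    letter_cases(3)
  by (simp add: writhe_def slices_block[OF w l] del: One_nat_def)

end

end


section \<open>Crossings away from the quadruple crossing\<close>

context closed_quadruple
begin

definition outer :: "nat \<Rightarrow> bool" where
  "outer q \<longleftrightarrow> q \<in> crossings T \<and> \<not> (first_level \<le> q \<and> q < first_level + 6)"

text \<open>The critical crossing lies directly above the block: a strand going up enters it from
  the first line of the block, but not at one of the four positions, where strands point
  down.\<close>

lemma outer_entries:
  assumes "outer q"
  shows "under_entry T q \<in> points T \<and> \<not> inside (under_entry T q)"
    "over_entry T q \<in> points T \<and> \<not> inside (over_entry T q)"
proof -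
  from assms obtain k h where q: "q < length (slices T)" "slices T ! q = Cross k h"
    by (auto simp: outer_def crossings_def)
  have "fits (Cross k h) (level T q)"
    using wf q by (metis wf_diagram_def)
  then have k: "k + 1 < length (level T q)"
    by simp
  have next_level: "level T (Suc q) = act (Cross k h) (level T q)"
    using q by (simp add: level_def take_Suc_conv_app_nth)
  have down: "\<not> inside (i, j)" if "level T i ! j = Up" for i j
  proof
    assume ins: "inside (i, j)"
    then obtain l m where "(i, j) = (first_level + l, shift Q + m)" "l < 6" "m < 4"
      by (rule insideE)
    then show False
      using level_block_Down[OF w\<^sub>0, of l m] that by simp
  qed
  have out: "\<not> inside (q, j)" for j
    using assms by (auto simp: outer_def inside_def)
  have out': "\<not> inside (Suc q, j)" if "level T (Suc q) ! j = Up" for j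
    using down[OF that] .
  have Up: "o' = Up" if "o' \<noteq> Down" for o'
    using that by (cases o') auto
  have "falling_entry T q \<in> points T \<and> \<not> inside (falling_entry T q)"
    using q k out out'[of "Suc k"] Up[of "level T q ! k"] next_level
    by (auto simp: falling_entry_def points_def)
  moreover have "rising_entry T q \<in> points T \<and> \<not> inside (rising_entry T q)"
    using q k out out'[of k] Up[of "level T q ! Suc k"] next_level
    by (auto simp: rising_entry_def points_def)
  ultimately show "under_entry T q \<in> points T \<and> \<not> inside (under_entry T q)"
    "over_entry T q \<in> points T \<and> \<not> inside (over_entry T q)"
    by (simp_all add: under_entry_def over_entry_def q(2))
qed

lemma crossings_diagram_of:
  assumes "half_twist w"
  shows "crossings (diagram_of w) = {q. outer q} \<union> (\<lambda>l. first_level + l) ` {..<6}"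
proof (intro set_eqI)
  fix q
  have len: "length (slices (diagram_of w)) = length (slices T)"
    by (simp add: length_slices assms w\<^sub>0)
  show "q \<in> crossings (diagram_of w) \<longleftrightarrow> q \<in> {q. outer q} \<union> (\<lambda>l. first_level + l) ` {..<6}"
  proof (cases "first_level \<le> q \<and> q < first_level + 6")
    case True
    then obtain l where l: "q = first_level + l" "l < 6"
      using le_Suc_ex[of first_level q] by auto
    then show ?thesis
      using slices_block[OF assms l(2)] length_slices[OF assms] by (auto simp: crossings_def)
  next
    case False
    then show ?thesis
      using slices_other[OF assms False] len by (auto simp: crossings_def outer_def)
  qed
qed

context
  fixes w :: "nat list" and q :: nat
  assumes w: "half_twist w" and q: "outer q"
begin

lemma entry_outer:
  "under_entry (diagram_of w) q = under_entry T q" "over_entry (diagram_of w) q = over_entry T q"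
proof -
  have "slices (diagram_of w) ! q = slices T ! q"
    using q by (intro slices_other[OF w]) (simp add: outer_def)
  moreover from this have "falling_entry (diagram_of w) q = falling_entry T q"
    "rising_entry (diagram_of w) q = rising_entry T q"
    by (simp_all add: falling_entry_def rising_entry_def level_diagram_of[OF w])
  ultimately show "under_entry (diagram_of w) q = under_entry T q"
    "over_entry (diagram_of w) q = over_entry T q"
    by (simp_all add: under_entry_def over_entry_def split: slice.split)
qed

lemma time_entry_outer:
  "time (diagram_of w) \<sigma> base (under_entry (diagram_of w) q) = model_time (under_entry T q)"
  "time (diagram_of w) \<sigma> base (over_entry (diagram_of w) q) = model_time (over_entry T q)"
  using outer_entries[OF q] by (simp_all add: entry_outer time_diagram_of[OF w] relabel_outside)

lemma writhe_outer: "writhe (diagram_of w) q = writhe T q"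
  using q slices_other[OF w, of q] level_diagram_of[OF w] by (simp add: outer_def writhe_def)

end

lemma type1_outer:
  "half_twist w \<Longrightarrow> outer q \<Longrightarrow> type1 (diagram_of w) \<sigma> base q \<longleftrightarrow> type1 T \<sigma> base q"
  by (simp add: type1_def time_entry_outer w\<^sub>0)

lemma crossing_grading_outer:
  assumes "half_twist w" "outer q"
  shows "crossing_grading (diagram_of w) \<sigma> base q = crossing_grading T \<sigma> base q"
  unfolding crossing_grading_def bpoints_diagram_of[OF assms(1)] time_entry_outer[OF assms]
    time_entry_outer[OF w\<^sub>0 assms(2)] time_bpoint[OF assms(1)] time_bpoint[OF w\<^sub>0] ..

text \<open>Outer crossings see the triple crossing only through the over-cross of \<open>d\<close>,
  so their total is a function of its high branch \<open>c\<close>.\<close>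

definition outer_weight :: "bpoint set \<Rightarrow> nat \<Rightarrow> int" where
  "outer_weight A c = (\<Sum>q | outer q \<and> type1 T \<sigma> base q \<and> model_time (under_entry T q) < branch_time c
     \<and> crossing_grading T \<sigma> base q = A. writhe T q)"

text \<open>Entry times decide, unless the under-cross lies on the same branch as the over-cross of
  \<open>d\<close>; then the order of the letters decides.\<close>

definition f_inner :: "bpoint set \<Rightarrow> nat list \<Rightarrow> nat \<Rightarrow> nat \<Rightarrow> bool" where
  "f_inner A w d l \<longleftrightarrow> l \<noteq> d \<and> branch_time (under_branch w l) < branch_time (over_branch w l) \<and>
     (if under_branch w l = over_branch w d then l < d
      else branch_time (under_branch w l) < branch_time (over_branch w d)) \<and>
     branch_grading (under_branch w l) (over_branch w l) = A"

lemma weight_split: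
  assumes w: "half_twist w" and d: "d < 6"
  shows "(\<Sum>q | q \<in> f_crossings (diagram_of w) \<sigma> base (first_level + d) \<and>
      crossing_grading (diagram_of w) \<sigma> base q = A. writhe (diagram_of w) q) =
    outer_weight A (over_branch w d) + (\<Sum>l<6. if f_inner A w d l then 1 else 0)"
proof -
  let ?D = "diagram_of w"
  define O1 where "O1 = {q. outer q \<and> type1 T \<sigma> base q \<and>
    model_time (under_entry T q) < branch_time (over_branch w d) \<and> crossing_grading T \<sigma> base q = A}"
  define I1 where "I1 = {l \<in> {..<6}. f_inner A w d l}"
  have outer_iff: "q \<in> f_crossings ?D \<sigma> base (first_level + d) \<and> crossing_grading ?D \<sigma> base q = A
      \<longleftrightarrow> q \<in> O1" if "outer q" for q
    using that outer_entries(1)[OF that] branch_less(2)[OF w d] d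
    by (auto simp: O1_def f_crossings_def crossings_diagram_of[OF w] type1_outer[OF w]
        crossing_grading_outer[OF w] time_entry_outer[OF w] time_over_entry[OF w d]
        model_time_outside_less reachable_outside outer_def)
  have inner_iff: "first_level + l \<in> f_crossings ?D \<sigma> base (first_level + d) \<and>
      crossing_grading ?D \<sigma> base (first_level + l) = A \<longleftrightarrow> l \<in> I1" if "l < 6" for l
    using that d branch_time_less[of "under_branch w l" "over_branch w d" l d]
      branch_less(1)[OF w that] branch_less(2)[OF w d]
    by (auto simp: I1_def f_inner_def f_crossings_def crossings_diagram_of[OF w] type1_block[OF w]
        crossing_grading_block[OF w] time_under_entry[OF w] time_over_entry[OF w])
  have "{q. q \<in> f_crossings ?D \<sigma> base (first_level + d) \<and> crossing_grading ?D \<sigma> base q = A} =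
      O1 \<union> (\<lambda>l. first_level + l) ` I1"
  proof (intro set_eqI)
    fix q
    consider "outer q" | l where "l < 6" "q = first_level + l" | "q \<notin> crossings ?D"
      by (auto simp: crossings_diagram_of[OF w])
    then show "q \<in> {q. q \<in> f_crossings ?D \<sigma> base (first_level + d) \<and>
        crossing_grading ?D \<sigma> base q = A} \<longleftrightarrow> q \<in> O1 \<union> (\<lambda>l. first_level + l) ` I1"
    proof cases
      case 1
      then have "q \<notin> (\<lambda>l. first_level + l) ` I1"
        by (auto simp: outer_def I1_def)
      with outer_iff[OF 1] show ?thesis
        by blast
    next
      case 2
      then have "q \<notin> O1"
        by (auto simp: outer_def O1_def)
      with inner_iff[OF 2(1)] 2(2) show ?thesis
        by auto
    next
      case 3
      then show ?thesis
        by (auto simp: f_crossings_def O1_def I1_def crossings_diagram_of[OF w])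
    qed
  qed
  moreover have "O1 \<inter> (\<lambda>l. first_level + l) ` I1 = {}"
    by (auto simp: O1_def I1_def outer_def)
  moreover have "finite O1"
    by (rule finite_subset[of _ "{..<length (slices T)}"]) (auto simp: O1_def outer_def crossings_def)
  moreover have "finite I1"
    by (simp add: I1_def)
  ultimately have "(\<Sum>q | q \<in> f_crossings ?D \<sigma> base (first_level + d) \<and>
      crossing_grading ?D \<sigma> base q = A. writhe ?D q) =
      sum (writhe ?D) O1 + sum (writhe ?D) ((\<lambda>l. first_level + l) ` I1)"
    by (simp add: sum.union_disjoint)
  also have "sum (writhe ?D) O1 = outer_weight A (over_branch w d)"
    unfolding outer_weight_def by (rule sum.cong) (auto simp: O1_def writhe_outer[OF w])
  also have "sum (writhe ?D) ((\<lambda>l. first_level + l) ` I1) = (\<Sum>l\<in>I1. 1)"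
    by (subst sum.reindex) (auto simp: inj_on_def I1_def writhe_block[OF w])
  also have "\<dots> = (\<Sum>l<6. if f_inner A w d l then 1 else 0)"
    unfolding I1_def by (rule sum.inter_filter) simp
  finally show ?thesis .
qed

end


section \<open>The triple crossings of the meridian\<close>

context closed_quadruple
begin

text \<open>The types l_c and r_a together say that mid is met before low and high.\<close>

definition triple_data :: "triple \<Rightarrow> bpoint set \<Rightarrow> nat \<Rightarrow> nat \<Rightarrow> nat \<Rightarrow> int \<Rightarrow> bool" where
  "triple_data p A lo mi hi W \<longleftrightarrow>
     (d_type0 Q \<sigma> base p \<longleftrightarrow> \<not> branch_time lo < branch_time hi) \<and>
     (global_type_lc Q \<sigma> base p \<or> global_type_ra Q \<sigma> base p \<longleftrightarrow>
       branch_time mi < branch_time lo \<and> branch_time mi < branch_time hi) \<and>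
     hm_grading Q \<sigma> base p = branch_grading mi hi \<and> W_sum Q \<sigma> base A p = W"

text \<open>Reduces a triple crossing to a computation with its word: in the perturbation 121,
  \<open>ml\<close>, \<open>d\<close> and \<open>hm\<close> are the letters number \<open>r\<close>,
  \<open>r + 1\<close> and \<open>r + 2\<close>, counted from 0.\<close>

lemma triple_dataI:
  assumes word: "w = pre p @ map (\<lambda>i. i + (pos p - 1)) [1, 2, 1] @ post p" "half_twist w"
    and r: "length (pre p) = r" "r \<le> 3" and pos: "pos p \<in> {1, 2}"
    and branches: "arrangement w r ! (pos p - 1) = lo" "arrangement w r ! pos p = mi"
      "arrangement w r ! (pos p + 1) = hi"
    and d: "under_branch w (r + 1) = lo" "over_branch w (r + 1) = hi"
    and hm: "under_branch w (r + 2) = mi" "over_branch w (r + 2) = hi"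
  shows "triple_data p A lo mi hi
    (outer_weight A hi + (\<Sum>l<6. if f_inner A w (r + 1) l then 1 else 0))"
proof -
  have D: "perturbation Q p = diagram_of w"
    by (simp add: perturbation_def replace_triple_def word(1))
  have d_level: "d_crossing Q p = first_level + (r + 1)"
    and hm_level: "hm_crossing Q p = first_level + (r + 2)"
    and level: "triple_level Q p = first_level + r"
    by (simp_all add: d_crossing_def hm_crossing_def triple_level_def r(1))
  have d_type: "d_type0 Q \<sigma> base p \<longleftrightarrow> \<not> branch_time lo < branch_time hi"
    unfolding d_type0_def type0_def D d_level using r by (subst type1_block[OF word(2)]) (simp_all add: d[simplified])
  have hm_gr: "hm_grading Q \<sigma> base p = branch_grading mi hi"
    unfolding hm_grading_def D hm_level using r
    by (subst crossing_grading_block[OF word(2)]) (simp_all add: hm[simplified])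
  have "r + 1 < 6"
    using r by simp
  from weight_split[OF word(2) this]
  have W: "W_sum Q \<sigma> base A p = outer_weight A hi + (\<Sum>l<6. if f_inner A w (r + 1) l then 1 else 0)"
    unfolding W_sum_def D Let_def d_level d(2) .
  have time: "time (diagram_of w) \<sigma> base (first_level + r, shift Q + j) = branch_time (arrangement w r ! j) + r"
    if "j < 4" for j
    using time_block[OF word(2) _ that, of r] r by simp
  have "low Q p = (first_level + r, shift Q + (pos p - 1))" "mid Q p = (first_level + r, shift Q + pos p)"
    "high Q p = (first_level + r, shift Q + (pos p + 1))"
    using pos by (auto simp: low_def mid_def high_def level)
  then have times: "time (diagram_of w) \<sigma> base (low Q p) = branch_time lo + r"
    "time (diagram_of w) \<sigma> base (mid Q p) = branch_time mi + r"
    "time (diagram_of w) \<sigma> base (high Q p) = branch_time hi + r"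
    using time[of "pos p - 1"] time[of "pos p"] time[of "pos p + 1"] pos branches by auto
  have "lo < 4" "hi < 4" "lo \<noteq> hi"
    using branch_less[OF word(2), of "r + 1"] r d by simp_all
  then have "branch_time lo \<noteq> branch_time hi"
    using branch_time_neq[of lo hi 0 0] by simp
  then have "global_type_lc Q \<sigma> base p \<or> global_type_ra Q \<sigma> base p \<longleftrightarrow>
      branch_time mi < branch_time lo \<and> branch_time mi < branch_time hi"
    by (auto simp: global_type_lc_def global_type_ra_def met_in_order_def D times)
  with d_type hm_gr W show ?thesis
    by (simp add: triple_data_def)
qed

text \<open>The part determined by the branches of \<open>d\<close> alone. Crossings with under
  branch \<open>hi\<close> fail the strict inequality; whether they count depends on the word and is
  recorded separately.\<close>

definition inner_weight :: "bpoint set \<Rightarrow> nat \<Rightarrow> nat \<Rightarrow> int" where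
  "inner_weight A lo hi = (\<Sum>(c, c') \<leftarrow> [(0, 1), (0, 2), (0, 3), (1, 2), (1, 3), (2, 3)].
     if (c, c') \<noteq> (lo, hi) \<and> branch_time c < branch_time c' \<and> branch_time c < branch_time hi \<and>
        branch_grading c c' = A then 1 else 0)"

definition weight :: "bpoint set \<Rightarrow> nat \<Rightarrow> nat \<Rightarrow> int" where
  "weight A lo hi = outer_weight A hi + inner_weight A lo hi"

lemmas evaluate = half_twist_def arrangement_def swap_at_def under_branch_def over_branch_def

lemma sum_lessThan_6: "(\<Sum>l<6::nat. g l) = g 0 + g 1 + g 2 + g 3 + g 4 + (g 5 :: int)"
  by (simp add: eval_nat_numeral)

text \<open>
  The two weights of the branches 0, 1, 2 differ, because the under-cross of the crossing of 2 and 3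
  lies on the high branch 2: it is passed after \<open>d\<close> in the first triple crossing and before \<open>d\<close> in
  the fifth.
\<close>

lemma triple_data_meridian:
  shows "triple_data \<lparr>pre = [], pos = 1, post = [3, 2, 1], sign = 1\<rparr> A 0 1 2
      (weight A 0 2)"
    and "triple_data \<lparr>pre = [2, 1], pos = 2, post = [1], sign = 1\<rparr> A 0 1 3
      (weight A 0 3)"
    and "triple_data \<lparr>pre = [2, 3], pos = 1, post = [3], sign = 1\<rparr> A 0 2 3
      (weight A 0 3)"
    and "triple_data \<lparr>pre = [], pos = 2, post = [1, 2, 3], sign = 1\<rparr> A 1 2 3
      (weight A 1 3)"
    and "triple_data \<lparr>pre = [3, 2, 1], pos = 2, post = [], sign = - 1\<rparr> A 0 1 2
      (weight A 0 2 +
        (if branch_time 2 < branch_time 3 \<and> branch_grading 2 3 = A then 1 else 0))"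
    and "triple_data \<lparr>pre = [3], pos = 1, post = [3, 2], sign = - 1\<rparr> A 0 1 3
      (weight A 0 3)"
    and "triple_data \<lparr>pre = [1], pos = 2, post = [1, 2], sign = - 1\<rparr> A 0 2 3
      (weight A 0 3)"
    and "triple_data \<lparr>pre = [1, 2, 3], pos = 1, post = [], sign = - 1\<rparr> A 1 2 3
      (weight A 1 3)"
proof -
  show "triple_data \<lparr>pre = [], pos = 1, post = [3, 2, 1], sign = 1\<rparr> A 0 1 2
      (weight A 0 2)"
    using triple_dataI[of "[1, 2, 1, 3, 2, 1]"
        "\<lparr>pre = [], pos = 1, post = [3, 2, 1], sign = 1\<rparr>" 0 0 1 2 A]
    by (simp_all add: evaluate triple_data_def weight_def inner_weight_def sum_lessThan_6
      f_inner_def)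
  show "triple_data \<lparr>pre = [2, 1], pos = 2, post = [1], sign = 1\<rparr> A 0 1 3
      (weight A 0 3)"
    using triple_dataI[of "[2, 1, 2, 3, 2, 1]"
        "\<lparr>pre = [2, 1], pos = 2, post = [1], sign = 1\<rparr>" 2 0 1 3 A]
    by (simp_all add: evaluate triple_data_def weight_def inner_weight_def sum_lessThan_6
      f_inner_def)
  show "triple_data \<lparr>pre = [2, 3], pos = 1, post = [3], sign = 1\<rparr> A 0 2 3
      (weight A 0 3)"
    using triple_dataI[of "[2, 3, 1, 2, 1, 3]"
        "\<lparr>pre = [2, 3], pos = 1, post = [3], sign = 1\<rparr>" 2 0 2 3 A]
    by (simp_all add: evaluate triple_data_def weight_def inner_weight_def sum_lessThan_6
      f_inner_def)
  show "triple_data \<lparr>pre = [], pos = 2, post = [1, 2, 3], sign = 1\<rparr> A 1 2 3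
      (weight A 1 3)"
    using triple_dataI[of "[2, 3, 2, 1, 2, 3]"
        "\<lparr>pre = [], pos = 2, post = [1, 2, 3], sign = 1\<rparr>" 0 1 2 3 A]
    by (simp_all add: evaluate triple_data_def weight_def inner_weight_def sum_lessThan_6
      f_inner_def)
  show "triple_data \<lparr>pre = [3, 2, 1], pos = 2, post = [], sign = - 1\<rparr> A 0 1 2
      (weight A 0 2 +
        (if branch_time 2 < branch_time 3 \<and> branch_grading 2 3 = A then 1 else 0))"
    using triple_dataI[of "[3, 2, 1, 2, 3, 2]"
        "\<lparr>pre = [3, 2, 1], pos = 2, post = [], sign = - 1\<rparr>" 3 0 1 2 A]
    by (simp_all add: evaluate triple_data_def weight_def inner_weight_def sum_lessThan_6
      f_inner_def)
  show "triple_data \<lparr>pre = [3], pos = 1, post = [3, 2], sign = - 1\<rparr> A 0 1 3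
      (weight A 0 3)"
    using triple_dataI[of "[3, 1, 2, 1, 3, 2]"
        "\<lparr>pre = [3], pos = 1, post = [3, 2], sign = - 1\<rparr>" 1 0 1 3 A]
    by (simp_all add: evaluate triple_data_def weight_def inner_weight_def sum_lessThan_6
      f_inner_def)
  show "triple_data \<lparr>pre = [1], pos = 2, post = [1, 2], sign = - 1\<rparr> A 0 2 3
      (weight A 0 3)"
    using triple_dataI[of "[1, 2, 3, 2, 1, 2]"
        "\<lparr>pre = [1], pos = 2, post = [1, 2], sign = - 1\<rparr>" 1 0 2 3 A]
    by (simp_all add: evaluate triple_data_def weight_def inner_weight_def sum_lessThan_6
      f_inner_def)
  show "triple_data \<lparr>pre = [1, 2, 3], pos = 1, post = [], sign = - 1\<rparr> A 1 2 3
      (weight A 1 3)"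
    using triple_dataI[of "[1, 2, 3, 1, 2, 1]"
        "\<lparr>pre = [1, 2, 3], pos = 1, post = [], sign = - 1\<rparr>" 3 1 2 3 A]
    by (simp_all add: evaluate triple_data_def weight_def inner_weight_def sum_lessThan_6
      f_inner_def)
qed

end


section \<open>Reduction of the braid words\<close>

context quadruple_skein
begin

text \<open>The right word comes from both P_3 and P_4, the left one from P'_3 and P'_4, so two
  pairs cancel in the first sum.\<close>

lemma reduce_32132: "skein_eq b (braid [3, 2, 1, 3, 2]) (braid [2, 1, 3, 2, 1])"
proof -
  have "skein_eq b (braid [3, 2, 1, 3, 2]) (braid [3, 2, 3, 1, 2])"
    using far_commutation[of "[3, 2]" "[2]"] by simp
  also have "skein_eq b \<dots> (braid [2, 3, 2, 1, 2])"
    using skein_eq_sym[OF braid_relation(2)[of "[]" "[1, 2]"]] by simp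
  also have "skein_eq b \<dots> (braid [2, 3, 1, 2, 1])"
    using skein_eq_sym[OF braid_relation(1)[of "[2, 3]" "[]"]] by simp
  also have "skein_eq b \<dots> (braid [2, 1, 3, 2, 1])"
    using skein_eq_sym[OF far_commutation[of "[2]" "[2, 1]"]] by simp
  finally show ?thesis .
qed

text \<open>Cancels P'_2 against P_2 in the first sum.\<close>

lemma reduce_32123: "skein_eq b (braid [3, 2, 1, 2, 3]) (braid [1, 2, 3, 2, 1])"
proof -
  have "skein_eq b (braid [3, 2, 1, 2, 3]) (braid [3, 1, 2, 1, 3])"
    using skein_eq_sym[OF braid_relation(1)[of "[3]" "[3]"]] by simp
  also have "skein_eq b \<dots> (braid [1, 3, 2, 1, 3])"
    using skein_eq_sym[OF far_commutation[of "[]" "[2, 1, 3]"]] by simp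
  also have "skein_eq b \<dots> (braid [1, 3, 2, 3, 1])"
    using far_commutation[of "[1, 3, 2]" "[]"] by simp
  also have "skein_eq b \<dots> (braid [1, 2, 3, 2, 1])"
    using skein_eq_sym[OF braid_relation(2)[of "[1]" "[1]"]] by simp
  finally show ?thesis .
qed

text \<open>For P'_1. Subtracting \<open>reduce_13212\<close>, which is for P_1, removes
  \<open>[3, 2, 1]\<close> and leaves the uncancelled term of the first sum.\<close>

lemma reduce_23213: "skein_eq b (braid [2, 3, 2, 1, 3]) (braid [3, 2, 1] + smul laurent_z (braid [2, 3, 2, 1]))"
proof -
  have "skein_eq b (braid [2, 3, 2, 1, 3]) (braid [2, 3, 2, 3, 1])"
    using far_commutation[of "[2, 3, 2]" "[]"] by simp
  also have "skein_eq b \<dots> (braid [2, 2, 3, 2, 1])"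
    using skein_eq_sym[OF braid_relation(2)[of "[2]" "[1]"]] by simp
  also have "skein_eq b \<dots> (braid [3, 2, 1] + smul laurent_z (braid [2, 3, 2, 1]))"
    using quadratic_relation[of "[]" "[3, 2, 1]" 2] by simp
  finally show ?thesis .
qed

lemma reduce_13212: "skein_eq b (braid [1, 3, 2, 1, 2]) (braid [3, 2, 1] + smul laurent_z (braid [1, 3, 2, 1]))"
proof -
  have "skein_eq b (braid [1, 3, 2, 1, 2]) (braid [1, 3, 1, 2, 1])"
    using skein_eq_sym[OF braid_relation(1)[of "[1, 3]" "[]"]] by simp
  also have "skein_eq b \<dots> (braid [1, 1, 3, 2, 1])"
    using skein_eq_sym[OF far_commutation[of "[1]" "[2, 1]"]] by simp
  also have "skein_eq b \<dots> (braid [3, 2, 1] + smul laurent_z (braid [1, 3, 2, 1]))"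
    using quadratic_relation[of "[]" "[3, 2, 1]" 1] by simp
  finally show ?thesis .
qed

text \<open>With \<open>reduce_3212\<close>, this turns the braid difference of P'_3 in the second
  sum into that of P_3.\<close>

lemma reduce_3213: "skein_eq b (braid [3, 2, 1, 3]) (braid [2, 3, 2, 1])"
proof -
  have "skein_eq b (braid [3, 2, 1, 3]) (braid [3, 2, 3, 1])"
    using far_commutation[of "[3, 2]" "[]"] by simp
  also have "skein_eq b \<dots> (braid [2, 3, 2, 1])"
    using skein_eq_sym[OF braid_relation(2)[of "[]" "[1]"]] by simp
  finally show ?thesis .
qed

lemma reduce_3212: "skein_eq b (braid [3, 2, 1, 2]) (braid [1, 3, 2, 1])"
proof -
  have "skein_eq b (braid [3, 2, 1, 2]) (braid [3, 1, 2, 1])"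
    using skein_eq_sym[OF braid_relation(1)[of "[3]" "[]"]] by simp
  also have "skein_eq b \<dots> (braid [1, 3, 2, 1])"
    using skein_eq_sym[OF far_commutation[of "[]" "[2, 1]"]] by simp
  finally show ?thesis .
qed

text \<open>The first of the eight words with \<open>d\<close> = 14. The normal forms are chosen so
  that 231, 121, 323 and 132, each with factor \<open>laurent_z\<close>, occur twice with opposite
  signs, as do the two-letter words.\<close>

lemma reduce_2131: "skein_eq b (braid [2, 1, 3, 1]) (braid [2, 3] + smul laurent_z (braid [2, 3, 1]))"
proof -
  have "skein_eq b (braid [2, 1, 3, 1]) (braid [2, 3, 1, 1])"
    using far_commutation[of "[2]" "[1]"] by simp
  also have "skein_eq b \<dots> (braid [2, 3] + smul laurent_z (braid [2, 3, 1]))"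
    using quadratic_relation[of "[2, 3]" "[]" 1] by simp
  finally show ?thesis .
qed

lemma reduce_2121: "skein_eq b (braid [2, 1, 2, 1]) (braid [1, 2] + smul laurent_z (braid [1, 2, 1]))"
proof -
  have "skein_eq b (braid [2, 1, 2, 1]) (braid [1, 2, 1, 1])"
    using skein_eq_sym[OF braid_relation(1)[of "[]" "[1]"]] by simp
  also have "skein_eq b \<dots> (braid [1, 2] + smul laurent_z (braid [1, 2, 1]))"
    using quadratic_relation[of "[1, 2]" "[]" 1] by simp
  finally show ?thesis .
qed

lemma reduce_3232: "skein_eq b (braid [3, 2, 3, 2]) (braid [2, 3] + smul laurent_z (braid [3, 2, 3]))"
proof -
  have "skein_eq b (braid [3, 2, 3, 2]) (braid [3, 3, 2, 3])"
    using braid_relation(2)[of "[3]" "[]"] by simp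
  also have "skein_eq b \<dots> (braid [2, 3] + smul laurent_z (braid [3, 2, 3]))"
    using quadratic_relation[of "[]" "[2, 3]" 3] by simp
  finally show ?thesis .
qed

lemma reduce_3132: "skein_eq b (braid [3, 1, 3, 2]) (braid [1, 2] + smul laurent_z (braid [1, 3, 2]))"
proof -
  have "skein_eq b (braid [3, 1, 3, 2]) (braid [1, 3, 3, 2])"
    using skein_eq_sym[OF far_commutation[of "[]" "[3, 2]"]] by simp
  also have "skein_eq b \<dots> (braid [1, 2] + smul laurent_z (braid [1, 3, 2]))"
    using quadratic_relation[of "[1]" "[2]" 3] by simp
  finally show ?thesis .
qed

lemma reduce_2323: "skein_eq b (braid [2, 3, 2, 3]) (braid [3, 2] + smul laurent_z (braid [3, 2, 3]))"
proof -
  have "skein_eq b (braid [2, 3, 2, 3]) (braid [3, 2, 3, 3])"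
    using braid_relation(2)[of "[]" "[3]"] by simp
  also have "skein_eq b \<dots> (braid [3, 2] + smul laurent_z (braid [3, 2, 3]))"
    using quadratic_relation[of "[3, 2]" "[]" 3] by simp
  finally show ?thesis .
qed

lemma reduce_2313: "skein_eq b (braid [2, 3, 1, 3]) (braid [2, 1] + smul laurent_z (braid [2, 3, 1]))"
proof -
  have "skein_eq b (braid [2, 3, 1, 3]) (braid [2, 3, 3, 1])"
    using far_commutation[of "[2, 3]" "[]"] by simp
  also have "skein_eq b \<dots> (braid [2, 1] + smul laurent_z (braid [2, 3, 1]))"
    using quadratic_relation[of "[2]" "[1]" 3] by simp
  finally show ?thesis .
qed

lemma reduce_1312: "skein_eq b (braid [1, 3, 1, 2]) (braid [3, 2] + smul laurent_z (braid [1, 3, 2]))"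
proof -
  have "skein_eq b (braid [1, 3, 1, 2]) (braid [1, 1, 3, 2])"
    using skein_eq_sym[OF far_commutation[of "[1]" "[2]"]] by simp
  also have "skein_eq b \<dots> (braid [3, 2] + smul laurent_z (braid [1, 3, 2]))"
    using quadratic_relation[of "[]" "[3, 2]" 1] by simp
  finally show ?thesis .
qed

lemma reduce_1212: "skein_eq b (braid [1, 2, 1, 2]) (braid [2, 1] + smul laurent_z (braid [1, 2, 1]))"
proof -
  have "skein_eq b (braid [1, 2, 1, 2]) (braid [1, 1, 2, 1])"
    using skein_eq_sym[OF braid_relation(1)[of "[1]" "[]"]] by simp
  also have "skein_eq b \<dots> (braid [2, 1] + smul laurent_z (braid [1, 2, 1]))"
    using quadratic_relation[of "[]" "[2, 1]" 1] by simp
  finally show ?thesis .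
qed

text \<open>With \<open>reduce_2123\<close>, this turns the braid difference of P'_2 in the second
  sum into that of P_2.\<close>

lemma reduce_3123: "skein_eq b (braid [3, 1, 2, 3]) (braid [1, 2, 3, 2])"
proof -
  have "skein_eq b (braid [3, 1, 2, 3]) (braid [1, 3, 2, 3])"
    using skein_eq_sym[OF far_commutation[of "[]" "[2, 3]"]] by simp
  also have "skein_eq b \<dots> (braid [1, 2, 3, 2])"
    using skein_eq_sym[OF braid_relation(2)[of "[1]" "[]"]] by simp
  finally show ?thesis .
qed

lemma reduce_2123: "skein_eq b (braid [2, 1, 2, 3]) (braid [1, 2, 3, 1])"
proof -
  have "skein_eq b (braid [2, 1, 2, 3]) (braid [1, 2, 1, 3])"
    using skein_eq_sym[OF braid_relation(1)[of "[]" "[3]"]] by simp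
  also have "skein_eq b \<dots> (braid [1, 2, 3, 1])"
    using far_commutation[of "[1, 2]" "[]"] by simp
  finally show ?thesis .
qed

end


section \<open>The sum over the meridian\<close>

lemma sum_meridian:
  "sum g meridian =
    g \<lparr>pre = [], pos = 1, post = [3, 2, 1], sign = 1\<rparr>
    + g \<lparr>pre = [2, 1], pos = 2, post = [1], sign = 1\<rparr>
    + g \<lparr>pre = [2, 3], pos = 1, post = [3], sign = 1\<rparr>
    + g \<lparr>pre = [], pos = 2, post = [1, 2, 3], sign = 1\<rparr>
    + g \<lparr>pre = [3, 2, 1], pos = 2, post = [], sign = - 1\<rparr>
    + g \<lparr>pre = [3], pos = 1, post = [3, 2], sign = - 1\<rparr>
    + g \<lparr>pre = [1], pos = 2, post = [1, 2], sign = - 1\<rparr>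
    + g \<lparr>pre = [1, 2, 3], pos = 1, post = [], sign = - 1\<rparr>"
  by (simp add: meridian_def add.assoc)

context closed_quadruple
begin

sublocale skein_of_boundary: quadruple_skein Q "boundary_type T" w\<^sub>0
  using positive w\<^sub>0 wf by unfold_locales (auto simp: half_twist_def)

abbreviation braid :: "nat list \<Rightarrow> skein_element" where
  "braid w \<equiv> gen (diagram_of w)"

definition grading_coeff :: "bpoint set \<Rightarrow> nat \<Rightarrow> nat \<Rightarrow> nat \<Rightarrow> laurent" where
  "grading_coeff A lo mi hi =
    (if branch_time mi < branch_time lo \<and> branch_time mi < branch_time hi \<and> branch_grading mi hi = A
     then 1 else 0)"

text \<open>The condition on the type of \<open>d\<close> becomes a zero coefficient, so all eight
  triple crossings enter the sum and the cancellation is linear.\<close>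

definition weight_coeff :: "nat \<Rightarrow> nat \<Rightarrow> int \<Rightarrow> laurent" where
  "weight_coeff lo hi W = (if branch_time lo < branch_time hi then 0 else laurent_z * of_int W)"

lemma grading_term:
  "triple_data p A lo mi hi W \<Longrightarrow>
    (if (global_type_lc Q \<sigma> base p \<or> global_type_ra Q \<sigma> base p) \<and> hm_grading Q \<sigma> base p = A
     then smul (of_int (sign p)) y else 0) = smul (of_int (sign p) * grading_coeff A lo mi hi) y"
  by (simp add: triple_data_def grading_coeff_def)

lemma weight_term:
  "triple_data p A lo mi hi W \<Longrightarrow>
    (if d_type0 Q \<sigma> base p then smul (of_int (sign p) * laurent_z * of_int (W_sum Q \<sigma> base A p)) y
     else 0) = smul (of_int (sign p) * weight_coeff lo hi W) y"
  by (simp add: triple_data_def weight_coeff_def mult.assoc)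

lemma R1_reg_expand:
  "R1_reg Q \<sigma> base A =
    smul (grading_coeff A 0 1 2) (braid [2, 1, 3, 2, 1])
    + smul (grading_coeff A 0 1 3) (braid [2, 1, 3, 2, 1])
    + smul (grading_coeff A 0 2 3) (braid [2, 3, 2, 1, 3])
    + smul (grading_coeff A 1 2 3) (braid [3, 2, 1, 2, 3])
    + smul (- grading_coeff A 0 1 2) (braid [3, 2, 1, 3, 2])
    + smul (- grading_coeff A 0 1 3) (braid [3, 2, 1, 3, 2])
    + smul (- grading_coeff A 0 2 3) (braid [1, 3, 2, 1, 2])
    + smul (- grading_coeff A 1 2 3) (braid [1, 2, 3, 2, 1])
    + (smul (weight_coeff 0 2 (weight A 0 2)) (braid [2, 3, 2, 1] - braid [1, 3, 2, 1])
      + smul (weight_coeff 0 3 (weight A 0 3)) (braid [2, 1, 3, 1] - braid [2, 1, 2, 1])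
      + smul (weight_coeff 0 3 (weight A 0 3)) (braid [2, 3, 2, 3] - braid [2, 3, 1, 3])
      + smul (weight_coeff 1 3 (weight A 1 3)) (braid [3, 1, 2, 3] - braid [2, 1, 2, 3])
      + smul (- weight_coeff 0 2 (weight A 0 2 +
          (if branch_time 2 < branch_time 3 \<and> branch_grading 2 3 = A then 1 else 0)))
          (braid [3, 2, 1, 3] - braid [3, 2, 1, 2])
      + smul (- weight_coeff 0 3 (weight A 0 3)) (braid [3, 2, 3, 2] - braid [3, 1, 3, 2])
      + smul (- weight_coeff 0 3 (weight A 0 3)) (braid [1, 3, 1, 2] - braid [1, 2, 1, 2])
      + smul (- weight_coeff 1 3 (weight A 1 3)) (braid [1, 2, 3, 2] - braid [1, 2, 3, 1]))"
proof -
  have fin: "finite meridian"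
    by (simp add: meridian_def)
  show ?thesis
    unfolding R1_reg_def sum.inter_filter[OF fin] sum_meridian
      triple_data_meridian[THEN grading_term] triple_data_meridian[THEN weight_term]
    by (simp add: replace_triple_def eval_nat_numeral split del: if_split)
qed

lemma R1_reg_skein_eq_0: "skein_eq (boundary_type T) (R1_reg Q \<sigma> base A) 0"
proof -
  have "skein_eq (boundary_type T) (R1_reg Q \<sigma> base A)
    (smul (grading_coeff A 0 1 2) (braid [2, 1, 3, 2, 1])
    + smul (grading_coeff A 0 1 3) (braid [2, 1, 3, 2, 1])
    + smul (grading_coeff A 0 2 3) (braid [3, 2, 1] + smul laurent_z (braid [2, 3, 2, 1]))
    + smul (grading_coeff A 1 2 3) (braid [1, 2, 3, 2, 1])
    + smul (- grading_coeff A 0 1 2) (braid [2, 1, 3, 2, 1])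
    + smul (- grading_coeff A 0 1 3) (braid [2, 1, 3, 2, 1])
    + smul (- grading_coeff A 0 2 3) (braid [3, 2, 1] + smul laurent_z (braid [1, 3, 2, 1]))
    + smul (- grading_coeff A 1 2 3) (braid [1, 2, 3, 2, 1])
    + (smul (weight_coeff 0 2 (weight A 0 2)) (braid [2, 3, 2, 1] - braid [1, 3, 2, 1])
      + smul (weight_coeff 0 3 (weight A 0 3))
          ((braid [2, 3] + smul laurent_z (braid [2, 3, 1]))
            - (braid [1, 2] + smul laurent_z (braid [1, 2, 1])))
      + smul (weight_coeff 0 3 (weight A 0 3))
          ((braid [3, 2] + smul laurent_z (braid [3, 2, 3]))
            - (braid [2, 1] + smul laurent_z (braid [2, 3, 1])))
      + smul (weight_coeff 1 3 (weight A 1 3)) (braid [1, 2, 3, 2] - braid [1, 2, 3, 1])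
      + smul (- weight_coeff 0 2 (weight A 0 2 +
          (if branch_time 2 < branch_time 3 \<and> branch_grading 2 3 = A then 1 else 0)))
          (braid [2, 3, 2, 1] - braid [1, 3, 2, 1])
      + smul (- weight_coeff 0 3 (weight A 0 3))
          ((braid [2, 3] + smul laurent_z (braid [3, 2, 3]))
            - (braid [1, 2] + smul laurent_z (braid [1, 3, 2])))
      + smul (- weight_coeff 0 3 (weight A 0 3))
          ((braid [3, 2] + smul laurent_z (braid [1, 3, 2]))
            - (braid [2, 1] + smul laurent_z (braid [1, 2, 1])))
      + smul (- weight_coeff 1 3 (weight A 1 3)) (braid [1, 2, 3, 2] - braid [1, 2, 3, 1])))"
    (is "skein_eq _ _ ?R")
    unfolding R1_reg_expand
    by (intro skein_eq_add skein_eq_smul skein_eq_diff skein_eq_refl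
         skein_of_boundary.reduce_32132 skein_of_boundary.reduce_32123
        skein_of_boundary.reduce_23213 skein_of_boundary.reduce_13212
        skein_of_boundary.reduce_3213 skein_of_boundary.reduce_3212
        skein_of_boundary.reduce_2131 skein_of_boundary.reduce_2121
        skein_of_boundary.reduce_3232 skein_of_boundary.reduce_3132
        skein_of_boundary.reduce_2323 skein_of_boundary.reduce_2313
        skein_of_boundary.reduce_1312 skein_of_boundary.reduce_1212
        skein_of_boundary.reduce_3123 skein_of_boundary.reduce_2123)
  \<comment> \<open>In normal form the sum vanishes already in the free module, so comparing
    coefficients suffices.\<close>
  also have "?R = 0"
  proof -
    \<comment> \<open>The extra weight counts if branch 2 precedes 0 (\<open>d\<close> has type 0)
      and 3, and the crossing of 2 and 3 has grading \<open>A\<close>. This is the condition in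
      \<open>grading_coeff A 0 2 3\<close>, so it absorbs the remainder of the first sum.\<close>
    have *: "weight_coeff 0 2 (weight A 0 2 +
          (if branch_time 2 < branch_time 3 \<and> branch_grading 2 3 = A then 1 else 0)) =
        weight_coeff 0 2 (weight A 0 2) + laurent_z * grading_coeff A 0 2 3"
      using branch_time_neq[of 0 2 0 0]
      by (auto simp: weight_coeff_def grading_coeff_def algebra_simps)
    show ?thesis
      unfolding * by (rule poly_mapping_eqI) (simp add: lookup_add lookup_minus algebra_simps)
  qed
  finally show ?thesis .
qed

end

theorem proposition2:
  fixes n :: nat and Q :: quadruple and T :: diagram
    and \<sigma> :: "bpoint \<Rightarrow> bpoint" and base :: bpoint and A :: "bpoint set"
  assumes "positive_quadruple Q"
    and "T = insert_braid Q [1, 2, 1, 3, 2, 1]"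
    and "string_link n T"
    and "abstract_closure T \<sigma>"
    and "base \<in> bpoints T"
    and "grading T \<sigma> base A"
  shows "skein_eq (boundary_type T) (R1_reg Q \<sigma> base A) 0"
proof -
  interpret closed_quadruple Q \<sigma> base "[1, 2, 1, 3, 2, 1]"
    using assms by unfold_locales (simp_all add: string_link_def half_twist_def arrangement_def swap_at_def)
  show ?thesis
    unfolding assms(2) by (rule R1_reg_skein_eq_0)
qed

end
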